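(* Let $E\subseteq\mathbb R$ be an interval, let $(X_t)_{t\ge 0}$ be a stochastic process adapted to a filtration $(\mathcal F_t)_{t\ge0}$, and let $\mu_1,\mu_2$ be probability measures on $E$ with $\mu_1\preceq_{\mathrm{st}}\mu_2$. Let $\xi_1,\xi_2$ be random variables with values in $(0,\infty)$ such that $\xi_1\preceq_{\mathrm{hr}}\xi_2$. Assume: (U1) there is a family of probability measures $(\mathbb P_x)_{x\in E}$ such that $\mathbb P_x(X_t\in E\ \forall t\ge 0)=1$ for all $x\in E$ and $((X_t)_{t\ge0},(\mathcal F_t)_{t\ge0},(\mathbb P_x)_{x\in E})$ is a (time-homogeneous) Markov process; (U2) for all probability measures $\nu_1,\nu_2$ on $E$ and all $t>0$, $\nu_1\preceq_{\mathrm{st}}\nu_2$ implies $\mathbb P_{\nu_1}(X_t\in\cdot\,)\preceq_{\mathrm{st}}\mathbb P_{\nu_2}(X_t\in\cdot\,)$; and, for each $i\in\{1,2\}$, with $\mathbb P:=\mathbb P_{\mu_i}$: (E1) for every $t>0$ the probability measure $\mathbb P(X_t\in\cdot\,)$ is diffuse; (E2) $(X_t)_{t\ge 0}$ has $\mathbb P$-a.s. right-continuous paths and is quasi-left-continuous; (E3) for every boundary function $b$ it holds $\mathbb P$-a.s. that $\tau_b=\tau_b'$. Then for $i\in\{1,2\}$ there exist boundary functions $b_i$ such that $\tau_{b_i}$ under $\mathbb P_{\mu_i}$ has the same distribution as $\xi_i$ and $$b_1\le b_2\quad\text{pointwise.}$$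
   Context: A probability measure is diffuse if it has no atoms. A boundary function is a lower semicontinuous function $b:[0,\infty]\to[-\infty,\infty]$. For a boundary function $b$, $\tau_b:=\inf\{t>0: X_t\ge b(t)\}$ and $\tau_b':=\inf\{t>0: X_t>b(t)\}$ ($t$ ranging over $(0,\infty)$, $\inf\emptyset=\infty$). Quasi-left-continuity (under $\mathbb P$): for every non-decreasing sequence of stopping times $T_1\le T_2\le\dots$ with $T:=\lim_n T_n$ one has $\lim_n X_{T_n}=X_T$ $\mathbb P$-a.s. on $\{T<\infty\}$. Markov process means: $\mathbb P_x(X_0=x)=1$, $x\mapsto\mathbb P_x(A)$ is measurable for events $A$ determined by $X$, and $\mathbb P_x(X_{t+s}\in B\mid\mathcal F_t)=\mathbb P_{X_t}(X_s\in B)$ $\mathbb P_x$-a.s. for all $s,t\ge0$, $x\in E$ and Borel $B\subseteq E$. For a probability measure $\nu$ on $E$, $\mathbb P_\nu:=\int_E\mathbb P_x\,\nu(dx)$. The filtration is understood to fulfill the usual conditions under $\mathbb P_{\mu_1}$ and $\mathbb P_{\mu_2}$. Usual stochastic order: $\mu\preceq_{\mathrm{st}}\nu$ means $\mu((-\infty,c])\ge\nu((-\infty,c])$ for all $c\in\mathbb R$. Hazard rate order: for random variables $\xi,\zeta>0$ put $t^\zeta:=\sup\{t>0:\mathbb P(\zeta>t)>0\}$; then $\xi\preceq_{\mathrm{hr}}\zeta$ means that $[0,t^\zeta)\ni t\mapsto \mathbb P(\xi>t)/\mathbb P(\zeta>t)$ is a non-increasing function with values in $[0,1]$.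
   Formalization: The hazard rate order additionally requires t^{ξ1} ≤ t^{ξ2} (as displayed it would allow ξ1=2, ξ2=1, where the claim fails); the usual conditions are imposed by augmenting the filtration separately under each P_{μ_i}. *)

theory Defs
  imports "HOL-Probability.Probability"
begin

section \<open>Orders on distributions\<close>

text \<open>Measures on a Borel set \<open>E\<close> of reals are measures on \<open>restrict_space borel E\<close>;
  therefore the half-lines are intersected with the space of the measure.\<close>

definition st_le :: "real measure \<Rightarrow> real measure \<Rightarrow> bool" (infix "\<preceq>st" 50) where
  "\<mu> \<preceq>st \<nu> \<longleftrightarrow> (\<forall>c. \<P>(x in \<nu>. x \<le> c) \<le> \<P>(x in \<mu>. x \<le> c))"

definition survival_end :: "'a measure \<Rightarrow> ('a \<Rightarrow> real) \<Rightarrow> ereal" where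
  "survival_end N \<zeta> = (SUP t \<in> {t. 0 < t \<and> \<P>(\<omega> in N. t < \<zeta> \<omega>) > 0}. ereal t)"

text \<open>The ratio of the survival functions is only well defined on \<open>[0, t\<^sup>\<zeta>)\<close>. The comparison
  \<open>t\<^sup>\<xi> \<le> t\<^sup>\<zeta>\<close> says that the survival function of \<open>\<xi>\<close> vanishes wherever that of \<open>\<zeta>\<close> does. It is
  implied by the other two conditions except when \<open>t\<^sup>\<zeta>\<close> is finite and an atom of \<open>\<zeta>\<close>. In that case
  those conditions alone do not define an order: they would give \<open>2 \<preceq>hr 1\<close> for constants.\<close>

definition hr_le ::
  "'a measure \<Rightarrow> ('a \<Rightarrow> real) \<Rightarrow> 'b measure \<Rightarrow> ('b \<Rightarrow> real) \<Rightarrow> bool" where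
  "hr_le N \<xi> N' \<zeta> \<longleftrightarrow>
     (let D = {t. 0 \<le> t \<and> ereal t < survival_end N' \<zeta>};
          r = (\<lambda>t. \<P>(\<omega> in N. t < \<xi> \<omega>) / \<P>(\<omega> in N'. t < \<zeta> \<omega>))
      in survival_end N \<xi> \<le> survival_end N' \<zeta> \<and> antimono_on D r \<and> r ` D \<subseteq> {0..1})"

definition diffuse :: "real measure \<Rightarrow> bool" where
  "diffuse \<mu> \<longleftrightarrow> (\<forall>x. emeasure \<mu> {x} = 0)"


section \<open>Boundary functions and first passage times\<close>

definition boundary_function :: "(ennreal \<Rightarrow> ereal) \<Rightarrow> bool" where
  "boundary_function b \<longleftrightarrow> (\<forall>x. b x \<le> Liminf (at x) b)"

definition first_passage ::
  "(real \<Rightarrow> 'w \<Rightarrow> real) \<Rightarrow> (ennreal \<Rightarrow> ereal) \<Rightarrow> 'w \<Rightarrow> ennreal" where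
  "first_passage X b \<omega> = (INF t \<in> {t. 0 < t \<and> ereal (X t \<omega>) \<ge> b (ennreal t)}. ennreal t)"

definition strict_first_passage ::
  "(real \<Rightarrow> 'w \<Rightarrow> real) \<Rightarrow> (ennreal \<Rightarrow> ereal) \<Rightarrow> 'w \<Rightarrow> ennreal" where
  "strict_first_passage X b \<omega> = (INF t \<in> {t. 0 < t \<and> ereal (X t \<omega>) > b (ennreal t)}. ennreal t)"


section \<open>Markov families\<close>

text \<open>A process is a family \<open>X :: real \<Rightarrow> 'w \<Rightarrow> real\<close> of which only the times \<open>t \<ge> 0\<close> matter.
  Filtrations are indexed by \<open>ennreal\<close>, so that the stopping times of \<^theory>\<open>HOL-Probability.Stopping_Time\<close>
  take values in \<open>[0,\<infinity>]\<close>. Of \<open>F \<top>\<close> it is only required that it contains all the other \<open>F t\<close>; its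
  choice has no influence on which maps are stopping times.\<close>

definition process_algebra :: "'w set \<Rightarrow> (real \<Rightarrow> 'w \<Rightarrow> real) \<Rightarrow> 'w measure" where
  "process_algebra \<Omega> X = sigma \<Omega> {X t -` B \<inter> \<Omega> | t B. 0 \<le> t \<and> B \<in> sets borel}"

text \<open>\<open>M\<close> only provides the measurable space on which all the measures \<open>P x\<close> live. The value of
  \<open>P x\<close> outside \<open>E\<close> is irrelevant, since below \<open>X t \<in> E\<close> almost surely.\<close>

definition markov_process ::
  "'w measure \<Rightarrow> real set \<Rightarrow> (real \<Rightarrow> 'w \<Rightarrow> real) \<Rightarrow> (ennreal \<Rightarrow> 'w measure) \<Rightarrow>
   (real \<Rightarrow> 'w measure) \<Rightarrow> bool" where
  "markov_process M E X F P \<longleftrightarrow>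
     (\<forall>x\<in>E. prob_space (P x) \<and> sets (P x) = sets M) \<and>
     (\<forall>x\<in>E. \<P>(\<omega> in P x. X 0 \<omega> = x) = 1) \<and>
     (\<forall>A\<in>sets (process_algebra (space M) X).
        (\<lambda>x. measure (P x) A) \<in> borel_measurable (restrict_space borel E)) \<and>
     (\<forall>x\<in>E. \<forall>s\<ge>0. \<forall>t\<ge>0. \<forall>B\<in>sets borel. B \<subseteq> E \<longrightarrow>
        (AE \<omega> in P x.
           real_cond_exp (P x) (F (ennreal t)) (indicat_real {\<omega>' \<in> space M. X (t + s) \<omega>' \<in> B}) \<omega>
           = \<P>(\<omega>' in P (X t \<omega>). X s \<omega>' \<in> B)))"

text \<open>The measure \<open>\<integral> P x \<nu>(dx)\<close>. As \<open>x \<mapsto> P x A\<close> is only assumed to be measurable for events \<open>A\<close>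
  determined by the process, it lives on \<^const>\<open>process_algebra\<close>. Statements about it hold almost
  surely if they hold outside a subset of a null set of that \<open>\<sigma>\<close>-algebra, which is what \<open>AE\<close> means.\<close>

definition start_law ::
  "'w set \<Rightarrow> (real \<Rightarrow> 'w \<Rightarrow> real) \<Rightarrow> (real \<Rightarrow> 'w measure) \<Rightarrow> real measure \<Rightarrow> 'w measure" where
  "start_law \<Omega> X P \<nu> = bind \<nu> (\<lambda>x. restr_to_subalg (P x) (process_algebra \<Omega> X))"


section \<open>Usual conditions and quasi-left-continuity\<close>

text \<open>The smallest filtration that contains \<open>F\<close> and fulfils the usual conditions under \<open>Q\<close>. That a
  filtration be complete under two laws at once is too restrictive to be taken literally: if the
  laws are mutually singular (for instance for two deterministic starting points), then it would
  already contain all events at time \<open>0\<close>, so that by the Markov property \<open>X\<close> would be deterministic. So the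
  filtration is augmented separately under each law. The bound \<open>s = \<top>\<close> serves only to define the
  augmentation at \<open>\<top>\<close>.\<close>

definition usual_augmentation ::
  "'w measure \<Rightarrow> (ennreal \<Rightarrow> 'w measure) \<Rightarrow> ennreal \<Rightarrow> 'w measure" where
  "usual_augmentation Q F t =
     sigma (space Q)
       (\<Inter>s\<in>{s. t < s \<or> s = \<top>}. sigma_sets (space Q) (sets (F s) \<union> null_sets (completion Q)))"

lemma usual_augmentation_eq:
  assumes F: "filtration (space Q) F"
    and right_cont: "\<And>t. t < \<top> \<Longrightarrow> sets (F t) = (\<Inter>s\<in>{t<..}. sets (F s))"
    and complete: "null_sets (completion Q) \<subseteq> sets (F 0)"
  shows "sets (usual_augmentation Q F t) = sets (F t)"
proof -
  interpret filtration "space Q" F by fact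
  have "sigma_sets (space Q) (sets (F s) \<union> null_sets (completion Q)) = sets (F s)" for s
  proof -
    have "sets (F s) \<union> null_sets (completion Q) = sets (F s)"
      using complete sets_F_mono[of 0 s] by auto
    then show ?thesis
      using sets.sigma_sets_eq[of "F s"] by (simp add: space_F)
  qed
  then have "(\<Inter>s\<in>{s. t < s \<or> s = \<top>}. sigma_sets (space Q) (sets (F s) \<union> null_sets (completion Q)))
      = (\<Inter>s\<in>{s. t < s \<or> s = \<top>}. sets (F s))"
    by simp
  also have "\<dots> = sets (F t)"
  proof (cases "t = \<top>")
    case False
    then have "{s. t < s \<or> s = \<top>} = {t<..}"
      by (auto simp: less_top)
    with right_cont[of t] False show ?thesis
      by (simp add: less_top)
  qed auto
  finally show ?thesis
    unfolding usual_augmentation_def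
    using sets.sets_measure_of_eq[of "F t"] by (simp add: space_F)
qed

definition right_continuous_paths :: "'w measure \<Rightarrow> (real \<Rightarrow> 'w \<Rightarrow> real) \<Rightarrow> bool" where
  "right_continuous_paths Q X \<longleftrightarrow>
     (AE \<omega> in Q. \<forall>t\<ge>0. continuous (at_right t) (\<lambda>s. X s \<omega>))"

definition quasi_left_continuous ::
  "'w measure \<Rightarrow> (ennreal \<Rightarrow> 'w measure) \<Rightarrow> (real \<Rightarrow> 'w \<Rightarrow> real) \<Rightarrow> bool" where
  "quasi_left_continuous Q F X \<longleftrightarrow>
     (\<forall>T :: nat \<Rightarrow> 'w \<Rightarrow> ennreal.
        (\<forall>n. stopping_time F (T n)) \<and> (\<forall>\<omega>\<in>space Q. incseq (\<lambda>n. T n \<omega>)) \<longrightarrow>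
        (AE \<omega> in Q. (SUP n. T n \<omega>) < \<top> \<longrightarrow>
           (\<lambda>n. X (enn2real (T n \<omega>)) \<omega>) \<longlonglongrightarrow> X (enn2real (SUP n. T n \<omega>)) \<omega>))"

end

theory Submission
  imports Defs "HOL-Library.Diagonal_Subsequence"
begin

text \<open>On the grid of mesh \<open>2\<^sup>-\<^sup>n\<close> let the barriers be the successive conditional quantiles for which
  the first grid time at which \<open>X\<close> reaches its barrier has the survival function of \<open>\<xi>\<^sub>i\<close> on the grid;
  off the grid the barrier is \<open>\<infinity>\<close>. By the hazard rate order the conditional survival
  probabilities of \<open>\<xi>\<^sub>1\<close> per step are at most those of \<open>\<xi>\<^sub>2\<close>, so by induction over the grid the laws
  of \<open>X\<close> conditioned on survival stay stochastically ordered and the barriers are ordered.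

  Along a diagonal subsequence the barriers \<open>\<Gamma>\<close>-converge to lower semicontinuous functions \<open>b\<^sub>i\<close>, which
  inherit the order. Limit points of grid passage times are passage times of \<open>b\<^sub>i\<close>: apply quasi-left-continuity
  to the first times at which one of the barriers of index at least \<open>m\<close> is reached. Conversely,
  right-continuous paths cross \<open>b\<^sub>i\<close> strictly at some point of a fixed countable set, at which \<open>X\<close> is
  stochastically continuous, so that the approximating barriers are reached in time. As
  \<open>\<tau>\<^sub>b = \<tau>'\<^sub>b\<close> almost surely, both bounds concern the same distribution function.\<close>

section \<open>Markov families started from a law\<close>

text \<open>Two difficulties shape the limit argument. Passage times range over positive times, so
  grid hits that accumulate at time 0 would not produce a passage of the limit. Hits in
  \<open>(0, e]\<close> are therefore discarded, at a cost \<open>1 - G e\<close> that vanishes with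
  \<open>e\<close>. In the other direction a path crosses the limit boundary at a random time, while
  an approximating barrier is known to be low only at some deterministic time near a given one. A
  crossing thus has to be tied to fixed times and fixed levels before continuity in probability can
  be used.

  By (E1) the barriers reproduce the prescribed survival mass exactly, and a dyadic time belongs to
  all fine grids, so the hitting probability at such a time is eventually constant. The limit then
  bounds the probability that the strict passage happens before \<open>t\<close> from above, and the
  probability that the weak passage happens by \<open>t\<close> from below; (E3) closes the
  gap.\<close>

locale markov_family =
  fixes M :: "'w measure" and E :: "real set"
    and X :: "real \<Rightarrow> 'w \<Rightarrow> real" and F :: "ennreal \<Rightarrow> 'w measure"
    and P :: "real \<Rightarrow> 'w measure"
  assumes interval: "is_interval E"
    and filtr: "filtration (space M) F"
    and subalg: "\<And>t. subalgebra M (F t)"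
    and adapted: "\<And>t. 0 \<le> t \<Longrightarrow> X t \<in> borel_measurable (F (ennreal t))"
    and stays: "\<And>x. x \<in> E \<Longrightarrow> AE \<omega> in P x. \<forall>t\<ge>0. X t \<omega> \<in> E"
    and markov: "markov_process M E X F P"
begin

abbreviation PA :: "'w measure" where "PA \<equiv> process_algebra (space M) X"

abbreviation Q :: "real measure \<Rightarrow> 'w measure" where "Q \<equiv> start_law (space M) X P"

definition law_on_E :: "real measure \<Rightarrow> bool" where
  "law_on_E \<nu> \<longleftrightarrow> prob_space \<nu> \<and> sets \<nu> = sets (restrict_space borel E)"

lemma E_borel [measurable]: "E \<in> sets borel"
  using interval by (intro real_interval_borel_measurable)

lemma space_PA [simp]: "space PA = space M"
  unfolding process_algebra_def by (simp add: space_measure_of_conv)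

lemma X_measurable_PA [measurable]:
  assumes "0 \<le> t" shows "X t \<in> borel_measurable PA"
proof (rule measurableI)
  fix B :: "real set" assume "B \<in> sets borel"
  then have "X t -` B \<inter> space M \<in> {X t -` B \<inter> space M | t B. 0 \<le> t \<and> B \<in> sets borel}"
    using assms by blast
  then show "X t -` B \<inter> space PA \<in> sets PA"
    unfolding space_PA unfolding process_algebra_def
    by (subst sets_measure_of) (auto intro: sigma_sets.Basic)
qed simp

lemma X_measurable_M: "0 \<le> t \<Longrightarrow> X t \<in> borel_measurable M"
  using measurable_from_subalg[OF subalg adapted] by blast

lemma sets_PA_subset: "sets PA \<subseteq> sets M"
proof -
  have "{X t -` B \<inter> space M | t B. 0 \<le> t \<and> B \<in> sets borel} \<subseteq> sets M"
    using measurable_sets[OF X_measurable_M] by blast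
  then have "sigma_sets (space M) {X t -` B \<inter> space M | t B. 0 \<le> t \<and> B \<in> sets borel} \<subseteq> sets M"
    by (rule sets.sigma_sets_subset)
  then show ?thesis
    unfolding process_algebra_def by (subst sets_measure_of) auto
qed

lemmas markov_props =
  markov[unfolded markov_process_def, THEN conjunct1]
  markov[unfolded markov_process_def, THEN conjunct2, THEN conjunct1, THEN bspec]
  markov[unfolded markov_process_def, THEN conjunct2, THEN conjunct2, THEN conjunct1, THEN bspec]
  markov[unfolded markov_process_def, THEN conjunct2, THEN conjunct2, THEN conjunct2,
    THEN bspec, THEN spec, THEN mp, THEN spec, THEN mp, THEN bspec, THEN mp]

lemma prob_P: "x \<in> E \<Longrightarrow> prob_space (P x)"
  and sets_P: "x \<in> E \<Longrightarrow> sets (P x) = sets M"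
  and space_P: "x \<in> E \<Longrightarrow> space (P x) = space M"
  using markov_props(1) by (auto dest: sets_eq_imp_space_eq)

lemma subalgebra_PA: "x \<in> E \<Longrightarrow> subalgebra (P x) PA"
  using sets_PA_subset by (simp add: subalgebra_def space_P sets_P)

lemma subalgebra_F: "x \<in> E \<Longrightarrow> subalgebra (P x) (F t)"
  using subalg[of t] by (simp add: subalgebra_def space_P sets_P)

lemma kernel_measurable:
  "(\<lambda>x. restr_to_subalg (P x) PA) \<in> restrict_space borel E \<rightarrow>\<^sub>M prob_algebra PA"
proof (intro measurable_prob_algebraI measurable_subprob_algebra)
  fix x assume "x \<in> space (restrict_space borel E)"
  then have x: "x \<in> E" by simp
  show p: "prob_space (restr_to_subalg (P x) PA)"
    using prob_space_restr_to_subalg[OF subalgebra_PA prob_P] x by blast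
  then show "subprob_space (restr_to_subalg (P x) PA)"
    by (rule prob_space_imp_subprob_space)
  show "sets (restr_to_subalg (P x) PA) = sets PA"
    by (rule sets_restr_to_subalg[OF subalgebra_PA[OF x]])
next
  fix A assume A: "A \<in> sets PA"
  then have m: "(\<lambda>x. measure (P x) A) \<in> borel_measurable (restrict_space borel E)"
    by (rule markov_props(3))
  have "emeasure (restr_to_subalg (P x) PA) A = ennreal (measure (P x) A)" if "x \<in> E" for x
    using that A prob_P[OF that] 
    by (simp add: emeasure_restr_to_subalg[OF subalgebra_PA] prob_space_def finite_measure.emeasure_eq_measure)
  then show "(\<lambda>a. emeasure (restr_to_subalg (P a) PA) A) \<in> borel_measurable (restrict_space borel E)"
    using m by (subst measurable_cong[where g = "\<lambda>x. ennreal (measure (P x) A)"]) auto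
qed

section \<open>The process law for a given starting distribution\<close>

context
  fixes \<nu> assumes \<nu>: "law_on_E \<nu>"
begin

lemma law_space: "space \<nu> = E"
  using \<nu> sets_eq_imp_space_eq[of \<nu> "restrict_space borel E"] by (simp add: law_on_E_def)

lemma kernel_measurable_law: "(\<lambda>x. restr_to_subalg (P x) PA) \<in> \<nu> \<rightarrow>\<^sub>M prob_algebra PA"
  using kernel_measurable \<nu> measurable_cong_sets[of \<nu> "restrict_space borel E" "prob_algebra PA" "prob_algebra PA"]
  by (simp add: law_on_E_def)

lemma law_nonempty: "space \<nu> \<noteq> {}"
  using \<nu> unfolding law_on_E_def by (blast dest: prob_space.not_empty)

lemma sets_Q [measurable_cong]: "sets (Q \<nu>) = sets PA"
  unfolding start_law_def
  by (rule sets_bind) (use law_nonempty in \<open>auto simp: law_space sets_restr_to_subalg[OF subalgebra_PA]\<close>)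

lemma space_Q: "space (Q \<nu>) = space M"
  using sets_eq_imp_space_eq[OF sets_Q] by simp

lemma prob_Q: "prob_space (Q \<nu>)"
proof -
  have "\<nu> \<in> space (prob_algebra \<nu>)"
    using \<nu> by (simp add: space_prob_algebra law_on_E_def)
  from prob_space_bind'[OF this kernel_measurable_law] show ?thesis
    unfolding start_law_def .
qed

lemma nn_integral_Q:
  assumes "f \<in> borel_measurable PA"
  shows "(\<integral>\<^sup>+\<omega>. f \<omega> \<partial>Q \<nu>) = (\<integral>\<^sup>+x. \<integral>\<^sup>+\<omega>. f \<omega> \<partial>P x \<partial>\<nu>)"
  unfolding start_law_def
  by (subst nn_integral_bind[OF assms measurable_prob_algebraD[OF kernel_measurable_law]])
    (use assms in \<open>auto intro!: nn_integral_cong simp: law_space nn_integral_subalgebra2[OF subalgebra_PA]\<close>)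

lemma emeasure_Q:
  assumes "A \<in> sets PA"
  shows "emeasure (Q \<nu>) A = (\<integral>\<^sup>+x. emeasure (P x) A \<partial>\<nu>)"
  unfolding start_law_def
  by (subst emeasure_bind[OF law_nonempty measurable_prob_algebraD[OF kernel_measurable_law] assms])
    (use assms in \<open>auto intro!: nn_integral_cong simp: law_space emeasure_restr_to_subalg[OF subalgebra_PA]\<close>)

lemma AE_Q_stays:
  assumes "0 \<le> t" shows "AE \<omega> in Q \<nu>. X t \<omega> \<in> E"
proof -
  note [measurable] = X_measurable_PA[OF assms]
  have A: "{\<omega>\<in>space M. X t \<omega> \<notin> E} \<in> sets PA"
    using measurable_sets[OF X_measurable_PA[OF assms], of "- E"] by (simp add: vimage_def Int_def conj_commute)
  have "emeasure (P x) {\<omega>\<in>space M. X t \<omega> \<notin> E} = 0" if "x \<in> E" for x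
  proof -
    have "AE \<omega> in P x. X t \<omega> \<in> E"
      using stays[OF that] by eventually_elim (use assms in auto)
    then show ?thesis
      using AE_iff_measurable[of "{\<omega>\<in>space M. X t \<omega> \<notin> E}" "P x" "\<lambda>\<omega>. X t \<omega> \<in> E"] A sets_PA_subset that
      by (auto simp: space_P sets_P)
  qed
  then have "(\<integral>\<^sup>+x. emeasure (P x) {\<omega>\<in>space M. X t \<omega> \<notin> E} \<partial>\<nu>) = (\<integral>\<^sup>+x. 0 \<partial>\<nu>)"
    by (intro nn_integral_cong) (simp add: law_space)
  then have "emeasure (Q \<nu>) {\<omega>\<in>space M. X t \<omega> \<notin> E} = 0"
    by (simp add: emeasure_Q[OF A])
  then show ?thesis
    using AE_iff_measurable[of "{\<omega>\<in>space M. X t \<omega> \<notin> E}" "Q \<nu>" "\<lambda>\<omega>. X t \<omega> \<in> E"] A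
    by (simp add: space_Q sets_Q)
qed

end

text \<open>\<open>P y\<close> is unspecified for \<open>y\<close> outside \<open>E\<close>. The
  indicator extends the kernel by 0 to a Borel function on the whole line, which can be composed
  with \<open>X t\<close> although \<open>X t\<close> lies in \<open>E\<close> only almost
  surely.\<close>

definition transition :: "real \<Rightarrow> real set \<Rightarrow> real \<Rightarrow> real" where
  "transition s B y = indicat_real E y * measure (P y) {\<omega> \<in> space M. X s \<omega> \<in> B}"

lemma event_PA: "0 \<le> s \<Longrightarrow> B \<in> sets borel \<Longrightarrow> {\<omega> \<in> space M. X s \<omega> \<in> B} \<in> sets PA"
  using measurable_sets[OF X_measurable_PA, of s B] by (simp add: vimage_def Int_def conj_commute)

lemma transition_measurable:
  assumes "0 \<le> s" "B \<in> sets borel"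
  shows "transition s B \<in> borel_measurable borel"
proof -
  have "(\<lambda>x. measure (P x) {\<omega> \<in> space M. X s \<omega> \<in> B}) \<in> borel_measurable (restrict_space borel E)"
    by (rule markov_props(3)[OF event_PA[OF assms]])
  then show ?thesis
    unfolding transition_def by (subst (asm) borel_measurable_restrict_space_iff) auto
qed

lemma transition_bounds: "0 \<le> transition s B y" "transition s B y \<le> 1"
  using prob_P[of y] by (auto simp: transition_def indicator_def prob_space.prob_le_1)

text \<open>Integrating the conditional expectation over a past event \<open>A\<close> turns the
  Markov property into an identity of measures, and such identities can be averaged over the
  starting point.\<close>

lemma markov_P:
  assumes x: "x \<in> E" and "0 \<le> s" "0 \<le> t" and B: "B \<in> sets borel" "B \<subseteq> E"
    and A: "A \<in> sets (F (ennreal t))"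
  shows "emeasure (P x) {\<omega>\<in>A. X (t + s) \<omega> \<in> B}
    = (\<integral>\<^sup>+\<omega>. ennreal (indicat_real A \<omega> * transition s B (X t \<omega>)) \<partial>P x)"
proof -
  interpret prob_space "P x" by (rule prob_P[OF x])
  interpret sigma_finite_subalgebra "P x" "F (ennreal t)"
    using finite_measure_axioms subalgebra_F[OF x]
    by (intro finite_measure_subalgebra_is_sigma_finite) (auto simp: finite_measure_subalgebra_def finite_measure_subalgebra_axioms_def)
  let ?V = "{\<omega> \<in> space M. X (t + s) \<omega> \<in> B}"
  have V [measurable]: "?V \<in> sets (P x)"
    using event_PA[of "t+s" B] sets_PA_subset assms by (auto simp: sets_P)
  have A' [measurable]: "A \<in> sets (P x)"
    using A subalgebra_F[OF x] by (auto simp: subalgebra_def)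
  have Xt [measurable]: "X t \<in> borel_measurable (P x)"
    using X_measurable_M[OF \<open>0 \<le> t\<close>] sets_P[OF x] by (simp cong: measurable_cong_sets)
  note [measurable] = transition_measurable[OF \<open>0 \<le> s\<close> B(1)]
  have AE1: "AE \<omega> in P x. real_cond_exp (P x) (F (ennreal t)) (indicat_real ?V) \<omega> = transition s B (X t \<omega>)"
  proof -
    have "AE \<omega> in P x. real_cond_exp (P x) (F (ennreal t)) (indicat_real ?V) \<omega>
           = \<P>(\<omega>' in P (X t \<omega>). X s \<omega>' \<in> B)"
      by (rule markov_props(4)) fact+
    with stays[OF x] show ?thesis
      by eventually_elim (use \<open>0 \<le> t\<close> in \<open>auto simp: transition_def space_P\<close>)
  qed
  have "{\<omega>\<in>A. X (t + s) \<omega> \<in> B} = A \<inter> ?V"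
    using sets.sets_into_space[OF A'] by (auto simp: space_P[OF x])
  then have "measure (P x) {\<omega>\<in>A. X (t + s) \<omega> \<in> B} = (\<integral>\<omega>. indicat_real A \<omega> * indicat_real ?V \<omega> \<partial>P x)"
    by (simp add: indicator_inter_arith[symmetric])
  also have "\<dots> = (\<integral>\<omega>. indicat_real A \<omega> * real_cond_exp (P x) (F (ennreal t)) (indicat_real ?V) \<omega> \<partial>P x)"
    by (rule real_cond_exp_intg(2)[symmetric])
      (use A in \<open>auto simp: indicator_inter_arith[symmetric] intro!: integrable_real_indicator simp: less_top[symmetric]\<close>)
  also have "\<dots> = (\<integral>\<omega>. indicat_real A \<omega> * transition s B (X t \<omega>) \<partial>P x)"
  proof (rule integral_cong_AE)
    show "AE \<omega> in P x. indicat_real A \<omega> * real_cond_exp (P x) (F (ennreal t)) (indicat_real ?V) \<omega> =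
        indicat_real A \<omega> * transition s B (X t \<omega>)"
      using AE1 by eventually_elim simp
  qed measurable
  finally have "measure (P x) {\<omega>\<in>A. X (t + s) \<omega> \<in> B} = (\<integral>\<omega>. indicat_real A \<omega> * transition s B (X t \<omega>) \<partial>P x)" .
  moreover have "integrable (P x) (\<lambda>\<omega>. indicat_real A \<omega> * transition s B (X t \<omega>))"
    by (rule integrable_const_bound[where B=1]) (auto simp: indicator_def transition_bounds)
  ultimately show ?thesis
    using transition_bounds by (subst nn_integral_eq_integral) (auto simp: emeasure_eq_measure)
qed

text \<open>\<open>A\<close> has to lie in two \<sigma>-algebras: in the filtration at time
  \<open>t\<close> as an event of the past under each \<open>P x\<close>, and in \<open>PA\<close>
  because \<open>Q \<nu>\<close> lives there.\<close>

lemma markov_Q: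
  assumes \<nu>: "law_on_E \<nu>" and "0 \<le> s" "0 \<le> t" and B: "B \<in> sets borel" "B \<subseteq> E"
    and A: "A \<in> sets (F (ennreal t))" and A': "A \<in> sets PA"
  shows "emeasure (Q \<nu>) {\<omega>\<in>A. X (t + s) \<omega> \<in> B}
    = (\<integral>\<^sup>+\<omega>. ennreal (indicat_real A \<omega> * transition s B (X t \<omega>)) \<partial>Q \<nu>)"
proof -
  have "{\<omega>\<in>A. X (t + s) \<omega> \<in> B} = A \<inter> {\<omega> \<in> space M. X (t + s) \<omega> \<in> B}"
    using sets.sets_into_space[OF A'] by auto
  then have V: "{\<omega>\<in>A. X (t + s) \<omega> \<in> B} \<in> sets PA"
    using A' event_PA[of "t+s" B] assms by auto
  note [measurable] = X_measurable_PA[OF \<open>0 \<le> t\<close>] A' transition_measurable[OF \<open>0 \<le> s\<close> B(1)]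
  have "(\<lambda>\<omega>. ennreal (indicat_real A \<omega> * transition s B (X t \<omega>))) \<in> borel_measurable PA"
    by measurable
  then show ?thesis
    by (auto simp: emeasure_Q[OF \<nu> V] nn_integral_Q[OF \<nu>] law_space[OF \<nu>] markov_P assms intro!: nn_integral_cong)
qed

lemma emeasure_Q_transition:
  assumes \<nu>: "law_on_E \<nu>" and s: "0 \<le> s" and B: "B \<in> sets borel"
  shows "emeasure (Q \<nu>) {\<omega>\<in>space M. X s \<omega> \<in> B} = (\<integral>\<^sup>+y. ennreal (transition s B y) \<partial>\<nu>)"
  unfolding emeasure_Q[OF \<nu> event_PA[OF s B]]
proof (rule nn_integral_cong)
  fix y assume "y \<in> space \<nu>"
  then have y: "y \<in> E" by (simp add: law_space[OF \<nu>])
  interpret prob_space "P y" by (rule prob_P[OF y])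
  show "emeasure (P y) {\<omega>\<in>space M. X s \<omega> \<in> B} = ennreal (transition s B y)"
    using y by (simp add: transition_def emeasure_eq_measure)
qed

lemma emeasure_Q_0:
  assumes \<nu>: "law_on_E \<nu>" and B: "B \<in> sets borel"
  shows "emeasure (Q \<nu>) {\<omega>\<in>space M. X 0 \<omega> \<in> B} = emeasure \<nu> (B \<inter> E)"
proof -
  have "emeasure (P x) {\<omega>\<in>space M. X 0 \<omega> \<in> B} = indicator (B \<inter> E) x" if x: "x \<in> E" for x
  proof -
    interpret prob_space "P x" by (rule prob_P[OF x])
    have X0: "X 0 \<in> borel_measurable (P x)"
      using X_measurable_M[OF order_refl] by (simp add: measurable_cong_sets[OF sets_P[OF x] refl])
    have "prob {\<omega> \<in> space (P x). X 0 \<omega> = x} = 1"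
      by (rule markov_props(2)[OF x])
    moreover have "{\<omega> \<in> space (P x). X 0 \<omega> = x} \<in> events"
      using measurable_sets[OF X0, of "{x}"] by (simp add: vimage_def Int_def conj_commute)
    ultimately have "AE \<omega> in P x. X 0 \<omega> = x"
      by (simp add: prob_Collect_eq_1)
    then have "emeasure (P x) {\<omega>\<in>space M. X 0 \<omega> \<in> B} = emeasure (P x) (if x \<in> B then space M else {})"
      using event_PA[of 0 B] B sets_PA_subset
      by (intro emeasure_eq_AE) (auto simp: sets_P x space_P[OF x])
    then show ?thesis
      using x emeasure_space_1 space_P[OF x] by (simp add: indicator_def)
  qed
  then have "emeasure (Q \<nu>) {\<omega>\<in>space M. X 0 \<omega> \<in> B} = (\<integral>\<^sup>+x. indicator (B \<inter> E) x \<partial>\<nu>)"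
    by (auto simp: emeasure_Q[OF \<nu> event_PA] B law_space[OF \<nu>] intro!: nn_integral_cong)
  also have "\<dots> = emeasure \<nu> (B \<inter> E)"
    using \<nu> B by (intro nn_integral_indicator) (auto simp: law_on_E_def sets_restrict_space)
  finally show ?thesis .
qed

end

section \<open>Barriers on a time grid\<close>

text \<open>The value \<open>-\<infinity>\<close> for \<open>p = 0\<close> keeps the barriers comparable once one of the survival functions
  has vanished; otherwise the greatest quantile is taken.\<close>

definition level :: "'w measure \<Rightarrow> 'w set \<Rightarrow> ('w \<Rightarrow> real) \<Rightarrow> real \<Rightarrow> ereal" where
  "level N A Z p = (if p = 0 then - \<infinity> else Sup {c. measure N {\<omega>\<in>A. ereal (Z \<omega>) < c} \<le> p})"

lemma diffuse_distr_measure: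
  assumes "finite_measure N" "Z \<in> borel_measurable N" "diffuse (distr N borel Z)"
  shows "measure N {\<omega>\<in>space N. Z \<omega> = x} = 0"
proof -
  have "emeasure (distr N borel Z) {x} = emeasure N (Z -` {x} \<inter> space N)"
    by (rule emeasure_distr) (use assms in auto)
  moreover have "Z -` {x} \<inter> space N = {\<omega>\<in>space N. Z \<omega> = x}"
    by auto
  ultimately show ?thesis
    using assms(3) by (simp add: diffuse_def measure_def)
qed

text \<open>The function \<open>f\<close> is left-continuous, which gives \<open>f L \<le> p\<close>
  at the supremum \<open>L\<close>. To the right of \<open>L\<close> it exceeds \<open>p\<close>,
  and its right limit exceeds \<open>f L\<close> by no more than the mass of \<open>Z = L\<close>,
  which is null by diffuseness.\<close>

lemma measure_level:
  assumes "prob_space N" and A [measurable]: "A \<in> sets N" and Z [measurable]: "Z \<in> borel_measurable N"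
    and diff: "diffuse (distr N borel Z)" and p: "0 \<le> p" "p \<le> measure N A"
  shows "measure N {\<omega>\<in>A. ereal (Z \<omega>) < level N A Z p} = p"
proof (cases "p = 0")
  case True
  then show ?thesis by (simp add: level_def)
next
  case False
  interpret prob_space N by fact
  define f where "f c = prob {\<omega>\<in>A. ereal (Z \<omega>) < c}" for c
  define L where "L = Sup {c. f c \<le> p}"
  have sub: "A \<subseteq> space N" by (rule sets.sets_into_space[OF A])
  have less_sets: "{\<omega>\<in>A. ereal (Z \<omega>) < c} \<in> sets N" for c
  proof -
    have "{\<omega>\<in>A. ereal (Z \<omega>) < c} = A \<inter> {\<omega>\<in>space N. ereal (Z \<omega>) < c}" using sub by auto
    then show ?thesis by simp
  qed
  have "f (- \<infinity>) \<le> p" using p by (simp add: f_def)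
  then have "{c. f c \<le> p} \<noteq> {}" by blast
  from Sup_countable_SUP[OF this] obtain u :: "nat \<Rightarrow> ereal"
    where u: "incseq u" "range u \<subseteq> {c. f c \<le> p}" "L = (SUP i. u i)"
    unfolding L_def by blast
  have "(\<lambda>i. f (u i)) \<longlonglongrightarrow> prob (\<Union>i. {\<omega>\<in>A. ereal (Z \<omega>) < u i})"
    unfolding f_def using less_sets u(1)
    by (intro finite_Lim_measure_incseq) (auto simp: incseq_def intro: less_le_trans)
  moreover have "(\<Union>i. {\<omega>\<in>A. ereal (Z \<omega>) < u i}) = {\<omega>\<in>A. ereal (Z \<omega>) < L}"
    by (auto simp: u(3) less_SUP_iff)
  ultimately have "(\<lambda>i. f (u i)) \<longlonglongrightarrow> f L" by (simp add: f_def)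
  then have le: "f L \<le> p"
    by (rule LIMSEQ_le_const2) (use u(2) in auto)
  have ge: "p \<le> f L"
  proof (cases "L = \<infinity>")
    case True
    then have "{\<omega>\<in>A. ereal (Z \<omega>) < L} = A" by auto
    then show ?thesis using p by (simp add: f_def)
  next
    case False
    then have "{L<..} \<noteq> {}" by (auto intro!: exI[of _ \<infinity>] simp: less_top[symmetric])
    from Inf_countable_INF[OF this] obtain v :: "nat \<Rightarrow> ereal"
      where v: "decseq v" "range v \<subseteq> {L<..}" "Inf {L<..} = (INF i. v i)"
      by blast
    have L: "L = (INF i. v i)"
      using v(3) False by (simp add: Inf_greaterThan less_top[symmetric])
    have gt: "p < f (v i)" for i
    proof (rule ccontr)
      assume "\<not> p < f (v i)"
      then have "v i \<le> L" unfolding L_def by (intro Sup_upper) auto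
      then show False using v(2) by (meson greaterThan_iff leD rangeI subsetD)
    qed
    have "(\<lambda>i. f (v i)) \<longlonglongrightarrow> prob (\<Inter>i. {\<omega>\<in>A. ereal (Z \<omega>) < v i})"
      unfolding f_def using less_sets v(1)
      by (intro finite_Lim_measure_decseq) (auto simp: decseq_def intro: less_le_trans)
    then have "p \<le> prob (\<Inter>i. {\<omega>\<in>A. ereal (Z \<omega>) < v i})"
      by (rule LIMSEQ_le_const) (use gt in \<open>auto intro: less_imp_le\<close>)
    \<comment> \<open>At \<open>L = -\<infinity>\<close> the second set reads \<open>Z = 0\<close>;
      it is null as well, and the intersection on the left is empty.\<close>
    also have "\<dots> \<le> prob ({\<omega>\<in>A. ereal (Z \<omega>) < L} \<union> {\<omega>\<in>space N. Z \<omega> = real_of_ereal L})"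
    proof (rule finite_measure_mono)
      show "(\<Inter>i. {\<omega>\<in>A. ereal (Z \<omega>) < v i}) \<subseteq> {\<omega>\<in>A. ereal (Z \<omega>) < L} \<union> {\<omega>\<in>space N. Z \<omega> = real_of_ereal L}"
      proof
        fix \<omega> assume \<omega>: "\<omega> \<in> (\<Inter>i. {\<omega>\<in>A. ereal (Z \<omega>) < v i})"
        then have "ereal (Z \<omega>) \<le> L" unfolding L by (auto intro!: INF_greatest intro: less_imp_le)
        with \<omega> sub show "\<omega> \<in> {\<omega>\<in>A. ereal (Z \<omega>) < L} \<union> {\<omega>\<in>space N. Z \<omega> = real_of_ereal L}"
          by (cases L) auto
      qed
    qed (use less_sets in auto)
    also have "\<dots> \<le> f L + prob {\<omega>\<in>space N. Z \<omega> = real_of_ereal L}"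
      unfolding f_def by (rule measure_Un_le) (use less_sets in auto)
    also have "\<dots> = f L"
      by (simp add: diffuse_distr_measure[OF finite_measure_axioms Z diff])
    finally show ?thesis .
  qed
  show ?thesis
    using le ge False unfolding level_def f_def L_def by simp
qed

primrec survivors :: "'w measure \<Rightarrow> (nat \<Rightarrow> 'w \<Rightarrow> real) \<Rightarrow> (nat \<Rightarrow> real) \<Rightarrow> nat \<Rightarrow> 'w set" where
  "survivors N Y g 0 = space N"
| "survivors N Y g (Suc k) = {\<omega> \<in> survivors N Y g k.
     ereal (Y (Suc k) \<omega>) < level N (survivors N Y g k) (Y (Suc k)) (g (Suc k))}"

definition barrier :: "'w measure \<Rightarrow> (nat \<Rightarrow> 'w \<Rightarrow> real) \<Rightarrow> (nat \<Rightarrow> real) \<Rightarrow> nat \<Rightarrow> ereal" where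
  "barrier N Y g k = level N (survivors N Y g (k - 1)) (Y k) (g k)"

lemma survivors_Suc_barrier:
  "survivors N Y g (Suc k) = {\<omega> \<in> survivors N Y g k. ereal (Y (Suc k) \<omega>) < barrier N Y g (Suc k)}"
  by (simp add: barrier_def)

lemma survivors_eq:
  "survivors N Y g k = {\<omega>\<in>space N. \<forall>j\<in>{1..k}. ereal (Y j \<omega>) < barrier N Y g j}"
proof (induction k)
  case (Suc k)
  then show ?case
    unfolding survivors_Suc_barrier by (auto simp: atLeastAtMostSuc_conv)
qed simp

text \<open>\<open>G\<close> is not fixed to \<open>N\<close>: the Markov property needs the
  survivors both in \<open>PA\<close> and as events of the past in the filtration.\<close>

lemma survivors_sets:
  assumes "space G = space N" "\<And>j. 1 \<le> j \<Longrightarrow> j \<le> k \<Longrightarrow> Y j \<in> borel_measurable G"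
  shows "survivors N Y g k \<in> sets G"
proof -
  have "{\<omega>\<in>space G. \<forall>j\<in>{1..k}. ereal (Y j \<omega>) < barrier N Y g j} \<in> sets G"
    using assms(2) by (intro sets.sets_Collect_finite_All) auto
  then show ?thesis by (simp add: survivors_eq assms(1))
qed

text \<open>\<open>level\<close> works with unnormalised mass, so the quantile of step
  \<open>Suc k\<close> is taken for \<open>g (Suc k)\<close> and not for its quotient by
  \<open>g k\<close>. Antitonicity keeps it within the mass that is left.\<close>

lemma measure_survivors:
  assumes N: "prob_space N" and Y: "\<And>k. Y k \<in> borel_measurable N"
    and diff: "\<And>k. 1 \<le> k \<Longrightarrow> diffuse (distr N borel (Y k))"
    and g: "g 0 = 1" "antimono g" "\<And>k. 0 \<le> g k"
  shows "measure N (survivors N Y g k) = g k"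
proof (induction k)
  case 0
  then show ?case using g(1) N by (simp add: prob_space.prob_space)
next
  case (Suc k)
  have "measure N (survivors N Y g (Suc k)) = g (Suc k)"
    unfolding survivors.simps
    using survivors_sets[OF refl, of k Y N] Suc g antimonoD[OF g(2), of k "Suc k"]
    by (intro measure_level[OF N _ Y diff]) (auto intro: Y)
  then show ?case .
qed

section \<open>Comparison of the barriers\<close>

context markov_family
begin

text \<open>The Markov hypothesis speaks of target sets inside \<open>E\<close>, the stochastic
  order of half-lines; this passes between the two.\<close>

lemma emeasure_Q_within:
  assumes \<nu>: "law_on_E \<nu>" and t: "0 \<le> t" and A: "A \<in> sets PA" and B: "B \<in> sets borel"
  shows "emeasure (Q \<nu>) {\<omega>\<in>A. X t \<omega> \<in> B \<inter> E} = emeasure (Q \<nu>) {\<omega>\<in>A. X t \<omega> \<in> B}"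
proof (rule emeasure_eq_AE)
  show "AE \<omega> in Q \<nu>. (\<omega> \<in> {\<omega>\<in>A. X t \<omega> \<in> B \<inter> E}) = (\<omega> \<in> {\<omega>\<in>A. X t \<omega> \<in> B})"
    using AE_Q_stays[OF \<nu> t] by eventually_elim auto
  have "{\<omega>\<in>A. X t \<omega> \<in> C} \<in> sets (Q \<nu>)" if "C \<in> sets borel" for C
  proof -
    have "{\<omega>\<in>A. X t \<omega> \<in> C} = A \<inter> {\<omega>\<in>space M. X t \<omega> \<in> C}"
      using sets.sets_into_space[OF A] by auto
    then show ?thesis using A event_PA[OF t that] by (simp add: sets_Q[OF \<nu>])
  qed
  then show "{\<omega>\<in>A. X t \<omega> \<in> B \<inter> E} \<in> sets (Q \<nu>)" "{\<omega>\<in>A. X t \<omega> \<in> B} \<in> sets (Q \<nu>)"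
    using B by (simp_all only: sets.Int E_borel)
qed

text \<open>The Markov property as a restart: given a past event \<open>A\<close>, the later
  one-dimensional laws are those of a process started from the conditional law of
  \<open>X t\<close>. In this way (U2), a statement about starting laws, applies to laws conditioned
  on survival.\<close>

lemma conditional_start:
  assumes \<nu>: "law_on_E \<nu>" and t: "0 \<le> t" and A: "A \<in> sets PA" "A \<in> sets (F (ennreal t))"
    and pos: "0 < measure (Q \<nu>) A"
  obtains \<nu>' where "law_on_E \<nu>'"
    and "\<And>c. measure \<nu>' {x\<in>space \<nu>'. x \<le> c} = measure (Q \<nu>) {\<omega>\<in>A. X t \<omega> \<le> c} / measure (Q \<nu>) A"
    and "\<And>s c. 0 \<le> s \<Longrightarrow> measure (Q \<nu>') {\<omega>\<in>space M. X s \<omega> \<le> c}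
           = measure (Q \<nu>) {\<omega>\<in>A. X (t + s) \<omega> \<le> c} / measure (Q \<nu>) A"
proof -
  interpret prob_space "Q \<nu>" by (rule prob_Q[OF \<nu>])
  obtain e where e: "e \<in> E" using law_nonempty[OF \<nu>] law_space[OF \<nu>] by auto
  \<comment> \<open>\<open>X t\<close> is altered on the null event that it leaves \<open>E\<close>,
    so that its image measure is a law on \<open>E\<close>.\<close>
  define Y where "Y \<omega> = (if X t \<omega> \<in> E then X t \<omega> else e)" for \<omega>
  let ?U = "uniform_measure (Q \<nu>) A"
  define \<nu>' where "\<nu>' = distr ?U (restrict_space borel E) Y"
  have A' [measurable]: "A \<in> sets (Q \<nu>)" using A by (simp add: sets_Q[OF \<nu>])
  have Xm [measurable]: "X t \<in> borel_measurable (Q \<nu>)"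
    using X_measurable_PA[OF t] by (simp add: measurable_cong_sets[OF sets_Q[OF \<nu>] refl])
  have Y0 [measurable]: "Y \<in> borel_measurable (Q \<nu>)" unfolding Y_def by measurable
  have YE: "Y \<omega> \<in> E" for \<omega> using e by (simp add: Y_def)
  have Y1: "Y \<in> Q \<nu> \<rightarrow>\<^sub>M restrict_space borel E"
    using YE Y0 by (intro measurable_restrict_space2) auto
  then have Y2: "Y \<in> ?U \<rightarrow>\<^sub>M restrict_space borel E"
    by (simp add: measurable_cong_sets[OF sets_uniform_measure refl])
  have nz: "emeasure (Q \<nu>) A \<noteq> 0" using pos by (simp add: emeasure_eq_measure)
  have U: "prob_space ?U" using nz by (intro prob_space_uniform_measure) auto
  have \<nu>': "law_on_E \<nu>'"
    unfolding law_on_E_def \<nu>'_def using prob_space.prob_space_distr[OF U Y2] by simp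
  interpret U: prob_space ?U by (rule U)
  interpret N: prob_space \<nu>' using \<nu>' by (simp add: law_on_E_def)
  interpret QN: prob_space "Q \<nu>'" by (rule prob_Q[OF \<nu>'])
  have int: "(\<integral>\<^sup>+y. f y \<partial>\<nu>') = (\<integral>\<^sup>+\<omega>. f (X t \<omega>) * indicator A \<omega> \<partial>Q \<nu>) / emeasure (Q \<nu>) A"
    if f [measurable]: "f \<in> borel_measurable borel" for f
  proof -
    have "(\<integral>\<^sup>+y. f y \<partial>\<nu>') = (\<integral>\<^sup>+\<omega>. f (Y \<omega>) \<partial>?U)"
      unfolding \<nu>'_def by (rule nn_integral_distr[OF Y2]) (simp add: measurable_restrict_space1)
    also have "\<dots> = (\<integral>\<^sup>+\<omega>. f (Y \<omega>) * indicator A \<omega> \<partial>Q \<nu>) / emeasure (Q \<nu>) A"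
      by (rule nn_integral_uniform_measure) measurable
    also have "(\<integral>\<^sup>+\<omega>. f (Y \<omega>) * indicator A \<omega> \<partial>Q \<nu>) = (\<integral>\<^sup>+\<omega>. f (X t \<omega>) * indicator A \<omega> \<partial>Q \<nu>)"
    proof (rule nn_integral_cong_AE)
      show "AE \<omega> in Q \<nu>. f (Y \<omega>) * indicator A \<omega> = f (X t \<omega>) * indicator A \<omega>"
        using AE_Q_stays[OF \<nu> t] by eventually_elim (simp add: Y_def)
    qed
    finally show ?thesis .
  qed
  have 1: "measure \<nu>' {x\<in>space \<nu>'. x \<le> c} = measure (Q \<nu>) {\<omega>\<in>A. X t \<omega> \<le> c} / measure (Q \<nu>) A" for c
  proof -
    have "{x\<in>space \<nu>'. x \<le> c} \<in> sets \<nu>'"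
      using \<nu>' by (auto simp: law_on_E_def law_space[OF \<nu>'] sets_restrict_space intro!: image_eqI[of _ _ "{..c}"])
    then have "emeasure \<nu>' {x\<in>space \<nu>'. x \<le> c} = (\<integral>\<^sup>+y. indicator {x\<in>space \<nu>'. x \<le> c} y \<partial>\<nu>')"
      by simp
    also have "\<dots> = (\<integral>\<^sup>+y. indicator {..c} y \<partial>\<nu>')"
      by (intro nn_integral_cong) (auto simp: indicator_def)
    also have "\<dots> = (\<integral>\<^sup>+\<omega>. indicator {..c} (X t \<omega>) * indicator A \<omega> \<partial>Q \<nu>) / emeasure (Q \<nu>) A"
      by (rule int) simp
    also have "(\<integral>\<^sup>+\<omega>. indicator {..c} (X t \<omega>) * indicator A \<omega> \<partial>Q \<nu>)
        = (\<integral>\<^sup>+\<omega>. indicator (A \<inter> {\<omega>\<in>space (Q \<nu>). X t \<omega> \<le> c}) \<omega> \<partial>Q \<nu>)"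
      by (intro nn_integral_cong) (auto simp: indicator_def)
    also have "\<dots> = emeasure (Q \<nu>) (A \<inter> {\<omega>\<in>space (Q \<nu>). X t \<omega> \<le> c})"
      by (rule nn_integral_indicator) measurable
    also have "A \<inter> {\<omega>\<in>space (Q \<nu>). X t \<omega> \<le> c} = {\<omega>\<in>A. X t \<omega> \<le> c}"
      using sets.sets_into_space[OF A'] by auto
    finally show ?thesis
      using pos by (simp add: emeasure_eq_measure N.emeasure_eq_measure divide_ennreal)
  qed
  have 2: "measure (Q \<nu>') {\<omega>\<in>space M. X s \<omega> \<le> c} = measure (Q \<nu>) {\<omega>\<in>A. X (t + s) \<omega> \<le> c} / measure (Q \<nu>) A"
    if s: "0 \<le> s" for s c
  proof -
    have B: "{..c} \<inter> E \<in> sets borel" by simp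
    have "emeasure (Q \<nu>') {\<omega>\<in>space M. X s \<omega> \<le> c} = emeasure (Q \<nu>') {\<omega>\<in>space M. X s \<omega> \<in> {..c} \<inter> E}"
      using emeasure_Q_within[OF \<nu>' s, of "space M" "{..c}"] sets.top[of PA] by simp
    also have "\<dots> = (\<integral>\<^sup>+y. ennreal (transition s ({..c} \<inter> E) y) \<partial>\<nu>')"
      by (rule emeasure_Q_transition[OF \<nu>' s B])
    also have "\<dots> = (\<integral>\<^sup>+\<omega>. ennreal (transition s ({..c} \<inter> E) (X t \<omega>)) * indicator A \<omega> \<partial>Q \<nu>) / emeasure (Q \<nu>) A"
      by (rule int) (use transition_measurable[OF s B] in measurable)
    also have "(\<integral>\<^sup>+\<omega>. ennreal (transition s ({..c} \<inter> E) (X t \<omega>)) * indicator A \<omega> \<partial>Q \<nu>)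
        = (\<integral>\<^sup>+\<omega>. ennreal (indicat_real A \<omega> * transition s ({..c} \<inter> E) (X t \<omega>)) \<partial>Q \<nu>)"
      by (intro nn_integral_cong) (auto simp: indicator_def)
    also have "\<dots> = emeasure (Q \<nu>) {\<omega>\<in>A. X (t + s) \<omega> \<in> {..c} \<inter> E}"
      by (rule markov_Q[symmetric]) (use \<nu> s t B A in auto)
    also have "\<dots> = emeasure (Q \<nu>) {\<omega>\<in>A. X (t + s) \<omega> \<le> c}"
      using emeasure_Q_within[OF \<nu> add_nonneg_nonneg[OF t s] A(1), of "{..c}"] by simp
    finally show ?thesis
      using pos by (simp add: emeasure_eq_measure QN.emeasure_eq_measure divide_ennreal)
  qed
  show thesis using that[OF \<nu>' 1 2] .
qed

definition monotone_semigroup :: bool where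
  "monotone_semigroup \<longleftrightarrow> (\<forall>\<nu>1 \<nu>2 t. law_on_E \<nu>1 \<longrightarrow> law_on_E \<nu>2 \<longrightarrow> 0 < t \<longrightarrow> \<nu>1 \<preceq>st \<nu>2 \<longrightarrow>
     distr (Q \<nu>1) borel (X t) \<preceq>st distr (Q \<nu>2) borel (X t))"

lemma measure_distr_X:
  assumes "law_on_E \<nu>" "0 \<le> t"
  shows "measure (distr (Q \<nu>) borel (X t)) {x. x \<le> c} = measure (Q \<nu>) {\<omega>\<in>space M. X t \<omega> \<le> c}"
proof -
  have "X t \<in> borel_measurable (Q \<nu>)"
    using X_measurable_PA[OF assms(2)] by (simp add: measurable_cong_sets[OF sets_Q[OF assms(1)] refl])
  moreover have "X t -` {x. x \<le> c} \<inter> space (Q \<nu>) = {\<omega>\<in>space M. X t \<omega> \<le> c}"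
    by (auto simp: space_Q[OF assms(1)])
  ultimately show ?thesis by (subst measure_distr) auto
qed

text \<open>Restarting from the two conditional laws reduces the claim to (U2). The conditional
  distribution functions are compared in multiplied-out form throughout.\<close>

lemma conditional_st_step:
  assumes mono: monotone_semigroup and \<nu>1: "law_on_E \<nu>1" and \<nu>2: "law_on_E \<nu>2"
    and t: "0 \<le> t" and s: "0 < s"
    and A1: "A1 \<in> sets PA" "A1 \<in> sets (F (ennreal t))" "0 < measure (Q \<nu>1) A1"
    and A2: "A2 \<in> sets PA" "A2 \<in> sets (F (ennreal t))" "0 < measure (Q \<nu>2) A2"
    and st: "\<And>c. measure (Q \<nu>2) {\<omega>\<in>A2. X t \<omega> \<le> c} * measure (Q \<nu>1) A1
                \<le> measure (Q \<nu>1) {\<omega>\<in>A1. X t \<omega> \<le> c} * measure (Q \<nu>2) A2"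
  shows "measure (Q \<nu>2) {\<omega>\<in>A2. X (t + s) \<omega> \<le> c} * measure (Q \<nu>1) A1
                \<le> measure (Q \<nu>1) {\<omega>\<in>A1. X (t + s) \<omega> \<le> c} * measure (Q \<nu>2) A2"
proof -
  have frac: "x / b \<le> y / a \<longleftrightarrow> x * a \<le> y * b" if "0 < a" "0 < b" for x y a b :: real
    using that by (simp add: field_simps)
  obtain \<rho>1 where r1: "law_on_E \<rho>1"
    "\<And>c. measure \<rho>1 {x\<in>space \<rho>1. x \<le> c} = measure (Q \<nu>1) {\<omega>\<in>A1. X t \<omega> \<le> c} / measure (Q \<nu>1) A1"
    "\<And>s c. 0 \<le> s \<Longrightarrow> measure (Q \<rho>1) {\<omega>\<in>space M. X s \<omega> \<le> c}
           = measure (Q \<nu>1) {\<omega>\<in>A1. X (t + s) \<omega> \<le> c} / measure (Q \<nu>1) A1"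
    by (rule conditional_start[OF \<nu>1 t A1]) (rule that)
  obtain \<rho>2 where r2: "law_on_E \<rho>2"
    "\<And>c. measure \<rho>2 {x\<in>space \<rho>2. x \<le> c} = measure (Q \<nu>2) {\<omega>\<in>A2. X t \<omega> \<le> c} / measure (Q \<nu>2) A2"
    "\<And>s c. 0 \<le> s \<Longrightarrow> measure (Q \<rho>2) {\<omega>\<in>space M. X s \<omega> \<le> c}
           = measure (Q \<nu>2) {\<omega>\<in>A2. X (t + s) \<omega> \<le> c} / measure (Q \<nu>2) A2"
    by (rule conditional_start[OF \<nu>2 t A2]) (rule that)
  have "\<rho>1 \<preceq>st \<rho>2"
    unfolding st_le_def r1(2) r2(2) frac[OF A1(3) A2(3)] using st by blast
  then have "distr (Q \<rho>1) borel (X s) \<preceq>st distr (Q \<rho>2) borel (X s)"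
    using mono r1(1) r2(1) s unfolding monotone_semigroup_def by blast
  then have "measure (Q \<rho>2) {\<omega>\<in>space M. X s \<omega> \<le> c} \<le> measure (Q \<rho>1) {\<omega>\<in>space M. X s \<omega> \<le> c}"
    using s r1(1) r2(1) by (simp add: st_le_def measure_distr_X)
  then show ?thesis
    unfolding r1(3)[OF less_imp_le[OF s]] r2(3)[OF less_imp_le[OF s]] frac[OF A1(3) A2(3)] .
qed

text \<open>By \<open>p\<close> the second quantile takes at least as large a fraction of its mass,
  and by \<open>st\<close> the second variable is conditionally larger. So every level admissible
  for \<open>p1\<close> is admissible for \<open>p2\<close>, and the suprema compare. The case
  \<open>p1 = 0\<close> rests on the value -\<infinity>.\<close>

lemma level_le:
  assumes S: "finite_measure N1" "finite_measure N2" "A1 \<in> sets N1" "A2 \<in> sets N2"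
    and Z: "Z1 \<in> borel_measurable N1" "diffuse (distr N1 borel Z1)"
           "Z2 \<in> borel_measurable N2" "diffuse (distr N2 borel Z2)"
    and pos: "0 < measure N1 A1" "0 < measure N2 A2"
    and st: "\<And>c. measure N2 {\<omega>\<in>A2. Z2 \<omega> \<le> c} * measure N1 A1 \<le> measure N1 {\<omega>\<in>A1. Z1 \<omega> \<le> c} * measure N2 A2"
    and p: "p1 * measure N2 A2 \<le> measure N1 A1 * p2" and p0: "0 \<le> p1" "p2 = 0 \<Longrightarrow> p1 = 0"
  shows "level N1 A1 Z1 p1 \<le> level N2 A2 Z2 p2"
proof (cases "p1 = 0")
  case True then show ?thesis by (simp add: level_def)
next
  case False
  interpret N1: finite_measure N1 by fact
  interpret N2: finite_measure N2 by fact
  \<comment> \<open>The order is stated with \<open>\<le>\<close> and \<open>level\<close> with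
    \<open><\<close>; diffuseness makes them agree.\<close>
  have atMost_lessThan: "measure N {\<omega>\<in>A. Z \<omega> \<le> c} = measure N {\<omega>\<in>A. Z \<omega> < c}"
    if N: "finite_measure N" and A: "A \<in> sets N" and Z [measurable]: "Z \<in> borel_measurable N" and d: "diffuse (distr N borel Z)"
    for N :: "'x measure" and A Z and c :: real
  proof -
    interpret finite_measure N by fact
    have sub: "A \<subseteq> space N" using A by (rule sets.sets_into_space)
    have "{\<omega>\<in>A. Z \<omega> < c} = A \<inter> {\<omega>\<in>space N. Z \<omega> < c}" "{\<omega>\<in>A. Z \<omega> \<le> c} = A \<inter> {\<omega>\<in>space N. Z \<omega> \<le> c}"
      using sub by auto
    then have m: "{\<omega>\<in>A. Z \<omega> < c} \<in> sets N" "{\<omega>\<in>A. Z \<omega> \<le> c} \<in> sets N" using A by auto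
    have "measure N {\<omega>\<in>A. Z \<omega> \<le> c} \<le> measure N ({\<omega>\<in>A. Z \<omega> < c} \<union> {\<omega>\<in>space N. Z \<omega> = c})"
      using m sub by (intro finite_measure_mono) auto
    also have "\<dots> \<le> measure N {\<omega>\<in>A. Z \<omega> < c} + measure N {\<omega>\<in>space N. Z \<omega> = c}"
      using m by (intro measure_Un_le) auto
    finally have "measure N {\<omega>\<in>A. Z \<omega> \<le> c} \<le> measure N {\<omega>\<in>A. Z \<omega> < c}"
      by (simp add: diffuse_distr_measure[OF N Z d])
    moreover have "measure N {\<omega>\<in>A. Z \<omega> < c} \<le> measure N {\<omega>\<in>A. Z \<omega> \<le> c}"
      using m by (intro finite_measure_mono) auto
    ultimately show ?thesis by simp
  qed
  have "measure N2 {\<omega>\<in>A2. ereal (Z2 \<omega>) < c} \<le> p2"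
    if c: "measure N1 {\<omega>\<in>A1. ereal (Z1 \<omega>) < c} \<le> p1" for c
  proof -
    have "measure N2 {\<omega>\<in>A2. ereal (Z2 \<omega>) < c} * measure N1 A1
        \<le> measure N1 {\<omega>\<in>A1. ereal (Z1 \<omega>) < c} * measure N2 A2"
      using st atMost_lessThan[OF S(1,3) Z(1,2)] atMost_lessThan[OF S(2,4) Z(3,4)]
      by (cases c) simp_all
    also have "\<dots> \<le> p1 * measure N2 A2" using c by (intro mult_right_mono) auto
    also have "\<dots> \<le> p2 * measure N1 A1" using p by (simp add: mult.commute)
    finally show ?thesis using pos by (simp add: mult_le_cancel_right)
  qed
  then show ?thesis
    using False p0 unfolding level_def by (auto intro!: Sup_subset_mono)
qed

text \<open>Each step is a transport by the semigroup, which keeps the order by (U2), followed by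
  killing above the barriers. Killing keeps the order because the first barrier is the lower one and
  the first process loses the larger fraction of its mass.\<close>

lemma barrier_le_barrier:
  assumes mono: monotone_semigroup and \<mu>1: "law_on_E \<mu>1" and \<mu>2: "law_on_E \<mu>2" and st: "\<mu>1 \<preceq>st \<mu>2"
    and diff: "\<And>t. 0 < t \<Longrightarrow> diffuse (distr (Q \<mu>1) borel (X t))"
              "\<And>t. 0 < t \<Longrightarrow> diffuse (distr (Q \<mu>2) borel (X t))"
    and h: "0 < h"
    and g1: "g1 0 = 1" "antimono g1" "\<And>k. 0 \<le> g1 k"
    and g2: "g2 0 = 1" "antimono g2" "\<And>k. 0 \<le> g2 k"
    and hr: "\<And>k. g1 (Suc k) * g2 k \<le> g1 k * g2 (Suc k)" "\<And>k. g2 k = 0 \<Longrightarrow> g1 k = 0"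
  shows "barrier (Q \<mu>1) (\<lambda>k. X (real k * h)) g1 (Suc k) \<le> barrier (Q \<mu>2) (\<lambda>k. X (real k * h)) g2 (Suc k)"
proof -
  define Y where "Y = (\<lambda>k::nat. X (real k * h))"
  define S1 where "S1 = survivors (Q \<mu>1) Y g1"
  define S2 where "S2 = survivors (Q \<mu>2) Y g2"
  have YPA: "Y k \<in> borel_measurable PA" for k
    unfolding Y_def using h by (intro X_measurable_PA) auto
  have Ym: "Y k \<in> borel_measurable (Q \<nu>)" if "law_on_E \<nu>" for k \<nu>
    using YPA by (simp add: measurable_cong_sets[OF sets_Q[OF that] refl])
  have YF: "Y j \<in> borel_measurable (F (ennreal (real k * h)))" if "j \<le> k" for j k
  proof -
    have "sets (F (ennreal (real j * h))) \<subseteq> sets (F (ennreal (real k * h)))"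
      using that h by (intro filtration.sets_F_mono[OF filtr] ennreal_leI mult_right_mono) auto
    then have "subalgebra (F (ennreal (real k * h))) (F (ennreal (real j * h)))"
      by (simp add: subalgebra_def filtration.space_F[OF filtr])
    from measurable_from_subalg[OF this adapted] show ?thesis
      unfolding Y_def using h by simp
  qed
  have Ydiff: "diffuse (distr (Q \<mu>1) borel (Y k))" "diffuse (distr (Q \<mu>2) borel (Y k))" if "1 \<le> k" for k
    using diff[of "real k * h"] h that by (auto simp: Y_def)
  note prob = prob_Q[OF \<mu>1] prob_Q[OF \<mu>2]
  have m1: "measure (Q \<mu>1) (S1 k) = g1 k" for k
    unfolding S1_def by (rule measure_survivors[OF prob(1) Ym[OF \<mu>1] Ydiff(1) g1])
  have m2: "measure (Q \<mu>2) (S2 k) = g2 k" for k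
    unfolding S2_def by (rule measure_survivors[OF prob(2) Ym[OF \<mu>2] Ydiff(2) g2])
  have S_PA: "S1 k \<in> sets PA" "S2 k \<in> sets PA" for k
    unfolding S1_def S2_def using YPA \<mu>1 \<mu>2 by (auto intro!: survivors_sets simp: space_Q)
  have S_Q: "S1 k \<in> sets (Q \<mu>1)" "S2 k \<in> sets (Q \<mu>2)" for k
    using S_PA by (auto simp: sets_Q \<mu>1 \<mu>2)
  have S_F: "S1 k \<in> sets (F (ennreal (real k * h)))" "S2 k \<in> sets (F (ennreal (real k * h)))" for k
    unfolding S1_def S2_def using YF \<mu>1 \<mu>2
    by (auto intro!: survivors_sets simp: space_Q filtration.space_F[OF filtr])
  have fin: "finite_measure (Q \<mu>1)" "finite_measure (Q \<mu>2)"
    using prob by (auto simp: prob_space_def)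
  \<comment> \<open>Time and events are separate arguments, because the order is also needed at time
    \<open>Suc k\<close> on the survivors of step \<open>k\<close>, after the transport and before
    the killing.\<close>
  define D where "D k A1 A2 \<longleftrightarrow> (\<forall>c. measure (Q \<mu>2) {\<omega>\<in>A2. Y k \<omega> \<le> c} * measure (Q \<mu>1) A1
     \<le> measure (Q \<mu>1) {\<omega>\<in>A1. Y k \<omega> \<le> c} * measure (Q \<mu>2) A2)" for k A1 A2
  have step: "D (Suc k) (S1 k) (S2 k)" if "0 < g1 k" "D k (S1 k) (S2 k)" for k
  proof -
    have "0 < g2 k" using that hr(2)[of k] g2(3)[of k] by (auto simp: less_le)
    moreover have "real (Suc k) * h = real k * h + h" by (simp add: algebra_simps)
    ultimately show ?thesis
      using conditional_st_step[OF mono \<mu>1 \<mu>2 _ h S_PA(1) S_F(1) _ S_PA(2) S_F(2), of k] that h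
      unfolding D_def Y_def by (simp add: m1 m2)
  qed
  have bar: "barrier (Q \<mu>1) Y g1 (Suc k) \<le> barrier (Q \<mu>2) Y g2 (Suc k)"
    if D: "0 < g1 k \<Longrightarrow> D k (S1 k) (S2 k)" for k
  proof (cases "g1 k = 0")
    case True
    \<comment> \<open>Once the first survival mass is exhausted the conditional law no longer
      exists; the convention -\<infinity> in \<open>level\<close> settles the comparison.\<close>
    then have "g1 (Suc k) = 0"
      using antimonoD[OF g1(2), of k "Suc k"] g1(3)[of "Suc k"] by simp
    then show ?thesis by (simp add: barrier_def level_def)
  next
    case False
    then have pos: "0 < g1 k" "0 < g2 k"
      using g1(3)[of k] g2(3)[of k] hr(2)[of k] by (auto simp: less_le)
    show ?thesis
      unfolding barrier_def S1_def[symmetric] S2_def[symmetric] diff_Suc_1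
      using step[OF pos(1) D[OF pos(1)]] pos hr(1)[of k] hr(2)[of "Suc k"]
      by (intro level_le[OF fin S_Q Ym[OF \<mu>1] Ydiff(1) Ym[OF \<mu>2] Ydiff(2)])
        (auto simp: m1 m2 D_def g1)
  qed
  have "0 < g1 k \<Longrightarrow> D k (S1 k) (S2 k)" for k
  proof (induction k)
    case 0
    have "measure (Q \<nu>) {\<omega>\<in>space M. X 0 \<omega> \<le> c} = measure \<nu> {x\<in>space \<nu>. x \<le> c}" if \<nu>: "law_on_E \<nu>" for \<nu> c
    proof -
      have "{..c} \<inter> E = {x\<in>space \<nu>. x \<le> c}" by (auto simp: law_space[OF \<nu>])
      then show ?thesis
        using emeasure_Q_0[OF \<nu>, of "{..c}"] by (simp add: measure_def)
    qed
    then show ?case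
      using st m1[of 0] m2[of 0] g1(1) g2(1)
      by (auto simp: D_def S1_def S2_def Y_def st_le_def space_Q \<mu>1 \<mu>2)
  next
    case (Suc k)
    have "g1 (Suc k) \<le> g1 k" by (rule antimonoD[OF g1(2)]) simp
    then have pos: "0 < g1 k" "0 < g2 k"
      using Suc.prems hr(2)[of k] g2(3)[of k] by (auto simp: less_le)
    have Dk: "D (Suc k) (S1 k) (S2 k)"
      by (rule step[OF pos(1) Suc.IH[OF pos(1)]])
    define b1 where "b1 = barrier (Q \<mu>1) Y g1 (Suc k)"
    define b2 where "b2 = barrier (Q \<mu>2) Y g2 (Suc k)"
    have b: "b1 \<le> b2" unfolding b1_def b2_def by (rule bar[OF Suc.IH])
    have S: "S1 (Suc k) = {\<omega>\<in>S1 k. ereal (Y (Suc k) \<omega>) < b1}" "S2 (Suc k) = {\<omega>\<in>S2 k. ereal (Y (Suc k) \<omega>) < b2}"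
      unfolding S1_def S2_def b1_def b2_def by (rule survivors_Suc_barrier)+
    show ?case
      unfolding D_def
    proof
      fix c
      show "measure (Q \<mu>2) {\<omega>\<in>S2 (Suc k). Y (Suc k) \<omega> \<le> c} * measure (Q \<mu>1) (S1 (Suc k))
         \<le> measure (Q \<mu>1) {\<omega>\<in>S1 (Suc k). Y (Suc k) \<omega> \<le> c} * measure (Q \<mu>2) (S2 (Suc k))"
      \<comment> \<open>From \<open>b1\<close> on, the conditional distribution function of the
        first survivors is already 1. Below \<open>b1\<close> the killing changes neither event,
        only the normalising masses, and those are compared by the hazard rate order.\<close>
      proof (cases "ereal c < b1")
        case False
        then have "{\<omega>\<in>S1 (Suc k). Y (Suc k) \<omega> \<le> c} = S1 (Suc k)"
          by (auto simp: S not_less less_imp_le dest: less_le_trans)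
        moreover have "measure (Q \<mu>2) {\<omega>\<in>S2 (Suc k). Y (Suc k) \<omega> \<le> c} \<le> measure (Q \<mu>2) (S2 (Suc k))"
          using S_Q(2) by (intro finite_measure.finite_measure_mono[OF fin(2)]) auto
        ultimately show ?thesis
          using g1(3)[of "Suc k"] by (simp add: m1 m2 mult.commute mult_left_mono)
      next
        case True
        then have e: "{\<omega>\<in>S1 (Suc k). Y (Suc k) \<omega> \<le> c} = {\<omega>\<in>S1 k. Y (Suc k) \<omega> \<le> c}"
          "{\<omega>\<in>S2 (Suc k). Y (Suc k) \<omega> \<le> c} = {\<omega>\<in>S2 k. Y (Suc k) \<omega> \<le> c}"
          using b by (auto simp: S intro: le_less_trans[of _ "ereal c"] less_le_trans[of _ b1])
        let ?a1 = "measure (Q \<mu>1) {\<omega>\<in>S1 k. Y (Suc k) \<omega> \<le> c}"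
        let ?a2 = "measure (Q \<mu>2) {\<omega>\<in>S2 k. Y (Suc k) \<omega> \<le> c}"
        \<comment> \<open>The positive factor \<open>g1 k\<close> lets the order before killing and
          the hazard rate inequality be applied in turn; it is cancelled at the end.\<close>
        have "(?a2 * g1 (Suc k)) * g1 k = (?a2 * g1 k) * g1 (Suc k)" by simp
        also have "\<dots> \<le> (?a1 * g2 k) * g1 (Suc k)"
          using Dk g1(3) by (intro mult_right_mono) (auto simp: D_def m1 m2)
        also have "\<dots> = ?a1 * (g1 (Suc k) * g2 k)" by simp
        also have "\<dots> \<le> ?a1 * (g1 k * g2 (Suc k))"
          using hr(1)[of k] by (intro mult_left_mono) auto
        finally have "(?a2 * g1 (Suc k)) * g1 k \<le> (?a1 * g2 (Suc k)) * g1 k" by (simp add: ac_simps)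
        then show ?thesis
          using pos by (simp add: e m1 m2 mult_le_cancel_right)
      qed
    qed
  qed
  then show ?thesis using bar[of k] unfolding Y_def by blast
qed

end

section \<open>Limits of barriers\<close>

text \<open>A single predicate is settled by thinning out to the indices where it holds, if there
  are infinitely many; a diagonal sequence settles countably many at once.\<close>

lemma diagonal_dichotomy:
  fixes A :: "'k::countable \<Rightarrow> nat \<Rightarrow> bool"
  obtains r :: "nat \<Rightarrow> nat" where "strict_mono r"
    and "\<And>k. (\<forall>\<^sub>F n in sequentially. A k (r n)) \<or> (\<forall>\<^sub>F n in sequentially. \<not> A k (r n))"
proof -
  define P where "P k s \<longleftrightarrow> (\<forall>\<^sub>F n in sequentially. A (from_nat k) (s n)) \<or>
      (\<forall>\<^sub>F n in sequentially. \<not> A (from_nat k) (s n))" for k and s :: "nat \<Rightarrow> nat"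
  interpret subseqs P
  proof
    fix k and s :: "nat \<Rightarrow> nat"
    show "\<exists>r'. strict_mono r' \<and> P k (s \<circ> r')"
    proof (cases "\<forall>\<^sub>F n in sequentially. \<not> A (from_nat k) (s n)")
      case True
      then show ?thesis by (intro exI[of _ id]) (auto simp: P_def strict_mono_def)
    next
      case False
      then have inf: "infinite {n. A (from_nat k) (s n)}"
        using frequently_cofinite[of "\<lambda>n. A (from_nat k) (s n)"]
        by (simp add: frequently_def cofinite_eq_sequentially)
      show ?thesis
        using strict_mono_enumerate[OF inf] enumerate_in_set[OF inf]
        by (intro exI[of _ "enumerate {n. A (from_nat k) (s n)}"]) (auto simp: P_def)
    qed
  qed
  have sub: "P k (s \<circ> r)" if "strict_mono r" "P k s" for k s r
    using that eventually_subseq[OF that(1)] by (auto simp: P_def)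
  have "P k diagseq" for k
  proof -
    \<comment> \<open>The diagonal sequence is controlled by the \<open>k\<close>-th extraction only
      from some index on, which is enough for eventual statements.\<close>
    have "P k (diagseq \<circ> (+) (Suc k))"
      by (rule diagseq_holds) (rule sub)
    then show ?thesis
      using eventually_sequentially_seg[of "\<lambda>n. A (from_nat k) (diagseq n)" "Suc k"]
        eventually_sequentially_seg[of "\<lambda>n. \<not> A (from_nat k) (diagseq n)" "Suc k"]
      by (simp add: P_def add.commute)
  qed
  then have "(\<forall>\<^sub>F n in sequentially. A k (diagseq n)) \<or> (\<forall>\<^sub>F n in sequentially. \<not> A k (diagseq n))" for k
    using P_def[of "to_nat k" diagseq] by simp
  then show thesis using that[OF subseq_diagseq] by blast
qed

section \<open>Gamma-lower limits: stability, semicontinuity and recovery of values\<close>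

definition gamma_liminf :: "(nat \<Rightarrow> real \<Rightarrow> ereal) \<Rightarrow> real \<Rightarrow> ereal" where
  "gamma_liminf f t = Liminf (sequentially \<times>\<^sub>F nhds t) (\<lambda>(n, u). f n u)"

lemma gamma_liminf_le:
  assumes n: "filterlim n sequentially sequentially" and u: "u \<longlonglongrightarrow> t"
    and le: "\<And>m. f (n m) (u m) \<le> ereal (x m)" and x: "x \<longlonglongrightarrow> y"
  shows "gamma_liminf f t \<le> ereal y"
proof (rule dense_le)
  fix z assume "z < gamma_liminf f t"
  then have "\<forall>\<^sub>F p in sequentially \<times>\<^sub>F nhds t. z < (case p of (n, u) \<Rightarrow> f n u)"
    unfolding gamma_liminf_def by (rule less_LiminfD)
  moreover have "filterlim (\<lambda>m. (n m, u m)) (sequentially \<times>\<^sub>F nhds t) sequentially"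
    using n u by (rule filterlim_Pair)
  ultimately have "\<forall>\<^sub>F m in sequentially. z < f (n m) (u m)"
    by (auto simp: filterlim_iff)
  then have "\<forall>\<^sub>F m in sequentially. z \<le> ereal (x m)"
    by eventually_elim (use le in \<open>auto intro: less_imp_le less_le_trans\<close>)
  then show "z \<le> ereal y"
    using x by (intro tendsto_lowerbound[of "\<lambda>m. ereal (x m)"]) auto
qed

lemma gamma_liminf_mono:
  assumes "\<And>n u. f n u \<le> g n u"
  shows "gamma_liminf f t \<le> gamma_liminf g t"
  unfolding gamma_liminf_def using assms by (intro Liminf_mono always_eventually) auto

text \<open>A neighbourhood of \<open>t\<close> is also one of every point close to
  \<open>t\<close>, so a lower bound for the joint limit passes to these points. The intermediate
  \<open>y\<close> keeps the inequality strict.\<close>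

lemma gamma_liminf_lsc:
  assumes "z < gamma_liminf f t"
  shows "\<forall>\<^sub>F u in nhds t. z < gamma_liminf f u"
proof -
  obtain y where y: "z < y" "y < gamma_liminf f t" using dense[OF assms] by blast
  have "\<forall>\<^sub>F p in sequentially \<times>\<^sub>F nhds t. y < (case p of (n, u) \<Rightarrow> f n u)"
    using y(2) unfolding gamma_liminf_def by (rule less_LiminfD)
  then obtain A B where AB: "eventually A sequentially" "eventually B (nhds t)" "\<And>n u. A n \<Longrightarrow> B u \<Longrightarrow> y < f n u"
    by (auto simp: eventually_prod_filter)
  then have "\<forall>\<^sub>F u in nhds t. eventually B (nhds u)" by (simp add: eventually_eventually)
  then show ?thesis
  proof eventually_elim
    case (elim u)
    have "\<forall>\<^sub>F p in sequentially \<times>\<^sub>F nhds u. y \<le> (case p of (n, u) \<Rightarrow> f n u)"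
      unfolding eventually_prod_filter
      using AB elim by (intro exI[of _ A] exI[of _ B]) (auto intro: less_imp_le)
    then have "y \<le> gamma_liminf f u"
      unfolding gamma_liminf_def by (rule Liminf_bounded)
    with y(1) show ?case by simp
  qed
qed

text \<open>In general a small lower limit yields small values for infinitely many \<open>n\<close>
  only. The dichotomy on rational windows and thresholds upgrades this to all large
  \<open>n\<close>, which makes the lower limit a full Gamma-limit.\<close>

lemma gamma_liminf_lessD:
  assumes dich: "\<And>a c q. (\<forall>\<^sub>F n in sequentially. \<exists>u\<in>{of_rat a<..<of_rat c}. f n u < ereal (of_rat q)) \<or>
        (\<forall>\<^sub>F n in sequentially. \<not> (\<exists>u\<in>{of_rat a<..<of_rat c}. f n u < ereal (of_rat q)))"
    and less: "gamma_liminf f t < q" and \<delta>: "0 < \<delta>"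
  shows "\<forall>\<^sub>F n in sequentially. \<exists>u. \<bar>u - t\<bar> < \<delta> \<and> f n u < q"
proof -
  obtain a where a: "t - \<delta> < of_rat a" "of_rat a < t" using of_rat_dense[of "t - \<delta>" t] \<delta> by auto
  obtain c where c: "t < of_rat c" "of_rat c < t + \<delta>" using of_rat_dense[of t "t + \<delta>"] \<delta> by auto
  obtain y where y: "y < q" "\<not> (\<forall>\<^sub>F p in sequentially \<times>\<^sub>F nhds t. y < (case p of (n, u) \<Rightarrow> f n u))"
  proof -
    have "\<not> q \<le> gamma_liminf f t" using less by (simp add: not_le)
    then show thesis unfolding gamma_liminf_def le_Liminf_iff using that by blast
  qed
  obtain q' where q': "y < ereal (of_rat q')" "ereal (of_rat q') < q"
    using ereal_dense3[OF y(1)] by auto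
  let ?A = "\<lambda>n. \<exists>u\<in>{of_rat a<..<of_rat c}. f n u < ereal (of_rat q')"
  have "\<not> (\<forall>\<^sub>F n in sequentially. \<not> ?A n)"
  proof
    assume ev: "\<forall>\<^sub>F n in sequentially. \<not> ?A n"
    have "\<forall>\<^sub>F u in nhds t. u \<in> {of_rat a<..<of_rat c}"
      using a c by (intro eventually_nhds_in_open) auto
    then have "\<forall>\<^sub>F p in sequentially \<times>\<^sub>F nhds t. y < (case p of (n, u) \<Rightarrow> f n u)"
      unfolding eventually_prod_filter
    proof (intro exI conjI allI impI)
      fix n u assume "\<not> ?A n" "u \<in> {of_rat a<..<of_rat c :: real}"
      then have "ereal (of_rat q') \<le> f n u" by (meson not_less)
      with q'(1) show "y < (case (n, u) of (n, u) \<Rightarrow> f n u)" by simp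
    qed (use ev in auto)
    with y(2) show False by simp
  qed
  with dich have "\<forall>\<^sub>F n in sequentially. ?A n" by blast
  then show ?thesis
  proof eventually_elim
    case (elim n)
    then obtain u where u: "of_rat a < u" "u < of_rat c" "f n u < ereal (of_rat q')" by auto
    then have "\<bar>u - t\<bar> < \<delta>" using a c by (simp add: abs_less_iff)
    with less_trans[OF u(3) q'(2)] show ?case by blast
  qed
qed

text \<open>The values at \<open>0\<close> and \<open>\<infinity>\<close> have no influence on the passage times; \<open>-\<infinity>\<close> makes the
  function lower semicontinuous there.\<close>

definition boundary_of :: "(real \<Rightarrow> ereal) \<Rightarrow> ennreal \<Rightarrow> ereal" where
  "boundary_of \<beta> t = (if t = 0 \<or> t = \<top> then - \<infinity> else \<beta> (enn2real t))"

lemma boundary_of_ennreal [simp]: "0 < t \<Longrightarrow> boundary_of \<beta> (ennreal t) = \<beta> t"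
  by (simp add: boundary_of_def ennreal_eq_0_iff)

lemma boundary_function_gamma_liminf: "boundary_function (boundary_of (gamma_liminf f))"
  unfolding boundary_function_def
proof
  fix t
  show "boundary_of (gamma_liminf f) t \<le> Liminf (at t) (boundary_of (gamma_liminf f))"
  proof (cases "t = 0 \<or> t = \<top>")
    case True
    then show ?thesis by (auto simp: boundary_of_def)
  next
    case False
    show ?thesis
      unfolding le_Liminf_iff
    proof (intro allI impI)
      fix z assume "z < boundary_of (gamma_liminf f) t"
      then have "z < gamma_liminf f (enn2real t)" using False by (simp add: boundary_of_def)
      from gamma_liminf_lsc[OF this] have "\<forall>\<^sub>F u in nhds (enn2real t). z < gamma_liminf f u" .
      moreover have "(enn2real \<longlongrightarrow> enn2real t) (nhds t)"
        using False tendsto_enn2real[of "\<lambda>u. u" "enn2real t" "nhds t"]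
        by (simp add: less_top[symmetric] filterlim_ident)
      ultimately have 1: "\<forall>\<^sub>F u in nhds t. z < gamma_liminf f (enn2real u)"
        by (auto simp: filterlim_iff)
      have "\<forall>\<^sub>F u in nhds t. u \<in> {0<..<\<top>}"
        using False by (intro eventually_nhds_in_open) (auto simp: less_top[symmetric] zero_less_iff_neq_zero)
      with 1 have "\<forall>\<^sub>F u in nhds t. z < boundary_of (gamma_liminf f) u"
        by eventually_elim (auto simp: boundary_of_def)
      then show "\<forall>\<^sub>F u in at t. z < boundary_of (gamma_liminf f) u"
        by (auto simp: eventually_at_filter elim: eventually_mono)
    qed
  qed
qed

text \<open>The topology generated by the intervals \<open>[a, b)\<close> is hereditarily separable.\<close>

lemma countable_right_dense:
  fixes S :: "real set"
  obtains C where "countable C" "C \<subseteq> S" "\<And>s h. s \<in> S \<Longrightarrow> 0 < h \<Longrightarrow> C \<inter> {s..<s + h} \<noteq> {}"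
proof -
  define I where "I p = (case p of (a, c) \<Rightarrow> S \<inter> {of_rat a<..<of_rat c})" for p :: "rat \<times> rat"
  define C1 where "C1 = (\<lambda>p. SOME x. x \<in> I p) ` {p. I p \<noteq> {}}"
  have C1: "C1 \<subseteq> S"
  proof
    fix x assume "x \<in> C1"
    then obtain p where "I p \<noteq> {}" "x = (SOME x. x \<in> I p)" by (auto simp: C1_def)
    then have "x \<in> I p" by (simp add: some_in_eq)
    then show "x \<in> S" by (auto simp: I_def split: prod.splits)
  qed
  have C1_dense: "\<exists>x\<in>C1. a < x \<and> x < c" if y: "y \<in> S" "a < y" "y < c" for a c y
  proof -
    obtain a' c' where "a < of_rat a'" "of_rat a' < y" "y < of_rat c'" "of_rat c' < c"
      using of_rat_dense[OF y(2)] of_rat_dense[OF y(3)] by blast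
    moreover from this have "y \<in> I (a', c')" using that by (simp add: I_def)
    then have "(SOME x. x \<in> I (a', c')) \<in> I (a', c')" "(SOME x. x \<in> I (a', c')) \<in> C1"
      by (auto simp: C1_def intro: someI)
    ultimately show ?thesis
      by (intro bexI[of _ "SOME x. x \<in> I (a', c')"]) (auto simp: I_def)
  qed
  \<comment> \<open>A point that \<open>C1\<close> misses to its right is followed by a gap of
    \<open>S\<close>. Different gaps contain different rationals, so there are countably many such
    points and they can be added to \<open>C1\<close>.\<close>
  define R where "R = {s\<in>S. \<exists>h>0. C1 \<inter> {s..<s + h} = {}}"
  have gap: "\<exists>q. s < of_rat q \<and> (\<forall>y\<in>S. s < y \<longrightarrow> of_rat q < y)" if s: "s \<in> R" for s
  proof -
    obtain h where h: "0 < h" "C1 \<inter> {s..<s + h} = {}" using s by (auto simp: R_def)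
    have "s + h \<le> y" if "y \<in> S" "s < y" for y
    proof (rule ccontr)
      assume "\<not> s + h \<le> y"
      then have "\<exists>x\<in>C1. s < x \<and> x < s + h" using that by (intro C1_dense) auto
      with h(2) show False by force
    qed
    moreover obtain q where "s < of_rat q" "of_rat q < s + h" using of_rat_dense[of s "s + h"] h(1) by auto
    ultimately show ?thesis by force
  qed
  then obtain q where q: "\<And>s. s \<in> R \<Longrightarrow> s < of_rat (q s)" "\<And>s y. s \<in> R \<Longrightarrow> y \<in> S \<Longrightarrow> s < y \<Longrightarrow> of_rat (q s) < y"
    by metis
  have "q s < q s'" if "s \<in> R" "s' \<in> R" "s < s'" for s s'
  proof -
    have "of_rat (q s) < s'" using that q(2) by (auto simp: R_def)
    also have "s' < of_rat (q s')" using that q(1) by auto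
    finally show ?thesis by (simp add: of_rat_less)
  qed
  then have "inj_on q R" by (intro linorder_inj_onI') (metis less_irrefl)
  then have "countable R" by (rule countableI')
  moreover have "countable C1" unfolding C1_def by (intro countable_image countableI_type)
  ultimately have "countable (C1 \<union> R)" by simp
  moreover have "C1 \<union> R \<subseteq> S" using C1 by (auto simp: R_def)
  moreover have "(C1 \<union> R) \<inter> {s..<s + h} \<noteq> {}" if "s \<in> S" "0 < h" for s h
  proof (cases "s \<in> R")
    case True then show ?thesis using that by auto
  next
    case False then show ?thesis using that by (auto simp: R_def)
  qed
  ultimately show thesis using that by blast
qed

text \<open>\<open>\<beta>\<close> may jump up immediately to the right of \<open>s\<close>, so an
  arbitrary dense set of times would miss \<open>s\<close>. Each rational sublevel set receives its
  own countable subset that is dense from the right.\<close>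

lemma countable_right_approximation:
  fixes \<beta> :: "real \<Rightarrow> ereal"
  obtains C where "countable C"
    and "\<And>s q h. \<beta> s < q \<Longrightarrow> 0 < h \<Longrightarrow> \<exists>c\<in>C. s \<le> c \<and> c < s + h \<and> \<beta> c < q"
proof -
  have "\<exists>C. countable C \<and> C \<subseteq> {s. \<beta> s < ereal (of_rat q)} \<and>
      (\<forall>s h. \<beta> s < ereal (of_rat q) \<longrightarrow> 0 < h \<longrightarrow> C \<inter> {s..<s + h} \<noteq> {})" for q
    using countable_right_dense[of "{s. \<beta> s < ereal (of_rat q)}"] by (metis mem_Collect_eq)
  then obtain C where C: "\<And>q. countable (C q)" "\<And>q. C q \<subseteq> {s. \<beta> s < ereal (of_rat q)}"
      "\<And>q s h. \<beta> s < ereal (of_rat q) \<Longrightarrow> 0 < h \<Longrightarrow> C q \<inter> {s..<s + h} \<noteq> {}"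
    by metis
  show thesis
  proof
    show "countable (\<Union>q. C q)" using C(1) by simp
    fix s q and h :: real assume "\<beta> s < q" "0 < h"
    then obtain r where r: "\<beta> s < ereal (of_rat r)" "ereal (of_rat r) < q" using ereal_dense3 by blast
    then obtain c where "c \<in> C r" "c \<in> {s..<s + h}" using C(3)[OF r(1) \<open>0 < h\<close>] by blast
    then show "\<exists>c\<in>\<Union>q. C q. s \<le> c \<and> c < s + h \<and> \<beta> c < q"
      using C(2)[of r] r(2) by (intro bexI[of _ c]) (auto dest: less_trans)
  qed
qed

section \<open>Passage times of limits of barriers\<close>

lemma space_usual_augmentation: "space (usual_augmentation N F t) = space N"
  by (simp add: usual_augmentation_def space_measure_of_conv)

lemma sets_usual_augmentation:
  assumes F: "filtration (space N) F" and A: "\<And>s. t < s \<or> s = \<top> \<Longrightarrow> A \<in> sets (F s)"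
  shows "A \<in> sets (usual_augmentation N F t)"
proof -
  let ?S = "\<lambda>s. sigma_sets (space N) (sets (F s) \<union> null_sets (completion N))"
  have sub: "sets (F s) \<union> null_sets (completion N) \<subseteq> Pow (space N)" for s
  proof -
    have "sets (F s) \<subseteq> Pow (space N)"
      using sets.space_closed[of "F s"] unfolding filtration.space_F[OF F] .
    moreover have "null_sets (completion N) \<subseteq> Pow (space N)"
      using sets.space_closed[of "completion N"] unfolding null_sets_def space_completion by blast
    ultimately show ?thesis by simp
  qed
  have "?S \<top> \<subseteq> Pow (space N)" using sigma_sets_into_sp[OF sub] by blast
  then have I: "(\<Inter>s\<in>{s. t < s \<or> s = \<top>}. ?S s) \<subseteq> Pow (space N)" by blast
  have "A \<in> (\<Inter>s\<in>{s. t < s \<or> s = \<top>}. ?S s)"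
  proof (rule INT_I)
    fix s assume "s \<in> {s. t < s \<or> s = \<top>}"
    then have "A \<in> sets (F s)" using A by blast
    then show "A \<in> ?S s" by (intro sigma_sets.Basic UnI1)
  qed
  then show ?thesis
    unfolding usual_augmentation_def sets_measure_of[OF I] by (rule sigma_sets.Basic)
qed

text \<open>For an infimum that need not be attained only the strict events are observable in time;
  the right-continuity built into the augmentation makes such an optional time a stopping
  time.\<close>

lemma stopping_time_usual_augmentation:
  fixes T :: "'w \<Rightarrow> ennreal"
  assumes F: "filtration (space N) F" and T: "\<And>r. {\<omega>\<in>space N. T \<omega> < r} \<in> sets (F r)"
  shows "stopping_time (usual_augmentation N F) T"
proof (rule stopping_timeI)
  fix t
  have "{\<omega>\<in>space N. T \<omega> \<le> t} \<in> sets (F s)" if "t < s \<or> s = \<top>" for s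
  proof (cases "t < s")
    case True
    obtain u where u: "\<And>n :: nat. t < u n" "u \<longlonglongrightarrow> t"
      using approx_from_above_dense_linorder[OF True] by auto
    \<comment> \<open>The levels are capped at \<open>s\<close> so that all the events on the right
      belong to \<open>F s\<close>.\<close>
    have "{\<omega>\<in>space N. T \<omega> \<le> t} = (\<Inter>n. {\<omega>\<in>space N. T \<omega> < min (u n) s})"
    proof safe
      fix \<omega> n assume "T \<omega> \<le> t"
      then show "T \<omega> < min (u n) s" using u(1)[of n] True by (simp add: le_less_trans)
    next
      fix \<omega> assume "\<omega> \<in> (\<Inter>n. {\<omega>\<in>space N. T \<omega> < min (u n) s})"
      then have "\<And>n. T \<omega> \<le> u n" by (auto intro: less_imp_le)
      then show "T \<omega> \<le> t" by (intro LIMSEQ_le_const[OF u(2)]) auto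
    qed auto
    moreover have "{\<omega>\<in>space N. T \<omega> < min (u n) s} \<in> sets (F s)" for n
      using T[of "min (u n) s"] filtration.sets_F_mono[OF F, of "min (u n) s" s] by auto
    ultimately show ?thesis by auto
  next
    case False
    then have "t = \<top>" "s = \<top>" using that by (auto simp: less_top[symmetric])
    then show ?thesis
      using sets.top[of "F \<top>"] by (simp add: filtration.space_F[OF F])
  qed
  then have "{\<omega>\<in>space N. T \<omega> \<le> t} \<in> sets (usual_augmentation N F t)"
    by (rule sets_usual_augmentation[OF F])
  then show "Measurable.pred (usual_augmentation N F t) (\<lambda>\<omega>. T \<omega> \<le> t)"
    by (simp add: pred_def space_usual_augmentation)
qed

section \<open>Auxiliary facts on limits, completions and measures of unions\<close>

lemma filterlim_at_right_sequentially:
  fixes S :: "nat \<Rightarrow> real"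
  assumes "\<And>n. s < S n" "S \<longlonglongrightarrow> s"
  shows "filterlim S (at_right s) sequentially"
  unfolding filterlim_at using assms(2) less_imp_neq[OF assms(1), symmetric]
  by (auto intro!: always_eventually assms(1))

text \<open>A first passage time is an infimum over uncountably many times; its measurability is
  obtained from an almost surely equal version.\<close>

lemma measurable_completion_AE_eq:
  assumes f: "f \<in> completion M \<rightarrow>\<^sub>M L" and ae: "AE x in completion M. f x = g x" and g: "g \<in> space M \<rightarrow> space L"
  shows "g \<in> completion M \<rightarrow>\<^sub>M L"
proof (rule measurableI)
  fix A assume A: "A \<in> sets L"
  have "AE x in completion M. x \<in> f -` A \<inter> space M \<longleftrightarrow> x \<in> g -` A \<inter> space M"
    using ae by eventually_elim auto
  moreover have "f -` A \<inter> space M \<in> sets (completion M)"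
    using measurable_sets[OF f A] by simp
  ultimately show "g -` A \<inter> space (completion M) \<in> sets (completion M)"
    unfolding space_completion by (rule completion.in_sets_AE) simp
qed (use g in auto)

lemma (in finite_measure) measure_countable_UN_le:
  assumes K: "countable K" and V: "\<And>k. k \<in> K \<Longrightarrow> V k \<in> sets M"
    and le: "\<And>J. finite J \<Longrightarrow> J \<subseteq> K \<Longrightarrow> measure M (\<Union>k\<in>J. V k) \<le> c"
  shows "measure M (\<Union>k\<in>K. V k) \<le> c"
proof (cases "K = {}")
  case True then show ?thesis using le[of "{}"] by simp
next
  case False
  define k where "k = from_nat_into K"
  have k: "range k = K" unfolding k_def by (rule range_from_nat_into[OF False K])
  have "(\<lambda>n. measure M (\<Union>i\<le>n. V (k i))) \<longlonglongrightarrow> measure M (\<Union>n. \<Union>i\<le>n. V (k i))"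
    using k V by (intro finite_Lim_measure_incseq) (auto simp: incseq_def, force)
  then have "measure M (\<Union>n. \<Union>i\<le>n. V (k i)) \<le> c"
  proof (rule LIMSEQ_le_const2, intro exI allI impI)
    fix n
    have "(\<Union>i\<le>n. V (k i)) = (\<Union>j\<in>k ` {..n}. V j)" by auto
    then show "measure M (\<Union>i\<le>n. V (k i)) \<le> c" using le[of "k ` {..n}"] k by auto
  qed
  moreover have "(\<Union>n. \<Union>i\<le>n. V (k i)) = (\<Union>j\<in>K. V j)" using k by auto
  ultimately show ?thesis by simp
qed

text \<open>The reverse Fatou inequality for events: the tail unions decrease, and each contains its
  first member.\<close>

lemma (in finite_measure) measure_INT_UN_ge:
  assumes B: "\<And>n :: nat. B n \<in> sets M" and ev: "\<forall>\<^sub>F n in sequentially. c \<le> measure M (B n)"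
  shows "c \<le> measure M (\<Inter>m. \<Union>n\<in>{m..}. B n)"
proof -
  have U: "(\<Union>n\<in>{m..}. B n) \<in> sets M" for m using B by auto
  have "(\<lambda>m. measure M (\<Union>n\<in>{m..}. B n)) \<longlonglongrightarrow> measure M (\<Inter>m. \<Union>n\<in>{m..}. B n)"
    using U by (intro finite_Lim_measure_decseq) (auto simp: decseq_def, force)
  moreover have "\<forall>\<^sub>F m in sequentially. c \<le> measure M (\<Union>n\<in>{m..}. B n)"
    using ev
  proof eventually_elim
    case (elim m)
    also have "measure M (B m) \<le> measure M (\<Union>n\<in>{m..}. B n)"
      by (rule finite_measure_mono[OF _ U]) auto
    finally show ?case .
  qed
  ultimately show ?thesis by (rule tendsto_lowerbound) simp
qed

text \<open>The limit argument concerns one law at a time and is run separately under each starting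
  law. \<open>D\<close> consists of times at which the hitting probabilities are eventually exact,
  \<open>C\<close> of times among which strict crossings can be sought.\<close>

locale passage_limit = prob_space N for N :: "'w measure" +
  fixes X :: "real \<Rightarrow> 'w \<Rightarrow> real" and F :: "ennreal \<Rightarrow> 'w measure"
    and f :: "nat \<Rightarrow> real \<Rightarrow> ereal" and G :: "real \<Rightarrow> real" and D C :: "real set"
  assumes filtr: "filtration (space N) F"
    and adapted: "\<And>t. 0 \<le> t \<Longrightarrow> X t \<in> borel_measurable (F (ennreal t))"
    and X_measurable: "\<And>t. 0 \<le> t \<Longrightarrow> X t \<in> borel_measurable N"
    and right_cont: "right_continuous_paths N X"
    and left_cont: "quasi_left_continuous N (usual_augmentation N F) X"
    and strict: "AE \<omega> in N. first_passage X (boundary_of (gamma_liminf f)) \<omega>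
        = strict_first_passage X (boundary_of (gamma_liminf f)) \<omega>"
    and sparse: "\<And>n. countable {u. f n u \<noteq> \<infinity>}"
    and recovery: "\<And>t q \<delta>. gamma_liminf f t < q \<Longrightarrow> 0 < \<delta> \<Longrightarrow>
        \<forall>\<^sub>F n in sequentially. \<exists>u. \<bar>u - t\<bar> < \<delta> \<and> f n u < q"
    and hits: "\<And>t. t \<in> D \<Longrightarrow> \<forall>\<^sub>F n in sequentially.
        measure N {\<omega>\<in>space N. \<exists>u. 0 < u \<and> u \<le> t \<and> f n u \<le> ereal (X u \<omega>)} = 1 - G t"
    and D_pos: "\<And>t. t \<in> D \<Longrightarrow> 0 < t"
    and D_dense: "\<And>t \<delta>. 0 \<le> t \<Longrightarrow> 0 < \<delta> \<Longrightarrow> \<exists>d\<in>D. t < d \<and> d < t + \<delta>"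
    and G_0: "G 0 = 1"
    and G_right: "\<And>t. 0 \<le> t \<Longrightarrow> (G \<longlongrightarrow> G t) (at_right t)"
    and C_countable: "countable C"
    and C_dense: "\<And>s q h. gamma_liminf f s < q \<Longrightarrow> 0 < h \<Longrightarrow>
        \<exists>c\<in>C. s \<le> c \<and> c < s + h \<and> gamma_liminf f c < q"
begin

definition hit :: "nat \<Rightarrow> real \<Rightarrow> real \<Rightarrow> 'w set" where
  "hit n a t = {\<omega>\<in>space N. \<exists>u. a < u \<and> u \<le> t \<and> f n u \<le> ereal (X u \<omega>)}"

lemma ge_sets: "0 \<le> u \<Longrightarrow> {\<omega>\<in>space N. c \<le> ereal (X u \<omega>)} \<in> sets (F (ennreal u))"
proof -
  assume "0 \<le> u"
  note [measurable] = adapted[OF this]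
  have "{\<omega>\<in>space (F (ennreal u)). c \<le> ereal (X u \<omega>)} \<in> sets (F (ennreal u))" by measurable
  then show ?thesis by (simp add: filtration.space_F[OF filtr])
qed

lemma ge_events: "0 \<le> u \<Longrightarrow> {\<omega>\<in>space N. c \<le> ereal (X u \<omega>)} \<in> events"
  using X_measurable[of u] by measurable

lemma hit_events: "0 \<le> a \<Longrightarrow> hit n a t \<in> events"
proof -
  assume a: "0 \<le> a"
  let ?S = "{u. f n u \<noteq> \<infinity>} \<inter> {a<..t}"
  have "hit n a t = (\<Union>u\<in>?S. {\<omega>\<in>space N. f n u \<le> ereal (X u \<omega>)})"
    by (auto simp: hit_def) force
  moreover have "countable ?S" using sparse by (rule countable_subset[rotated]) auto
  ultimately show ?thesis
    using ge_events a by (auto intro!: sets.countable_UN')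
qed

text \<open>Fewer barriers compete as \<open>m\<close> grows, so these times increase with
  \<open>m\<close>, as quasi-left-continuity demands. The cutoff \<open>a\<close> keeps their limit
  away from 0.\<close>

definition first_hit :: "real \<Rightarrow> nat \<Rightarrow> 'w \<Rightarrow> ennreal" where
  "first_hit a m \<omega> = (INF (n, u)\<in>{(n, u). m \<le> n \<and> a < u \<and> f n u \<le> ereal (X u \<omega>)}. ennreal u)"

lemma first_hit_less: "first_hit a m \<omega> < r \<longleftrightarrow> (\<exists>n u. m \<le> n \<and> a < u \<and> f n u \<le> ereal (X u \<omega>) \<and> ennreal u < r)"
  unfolding first_hit_def INF_less_iff by auto

lemma first_hit_le: "m \<le> n \<Longrightarrow> a < u \<Longrightarrow> f n u \<le> ereal (X u \<omega>) \<Longrightarrow> first_hit a m \<omega> \<le> ennreal u"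
  unfolding first_hit_def by (rule INF_lower2[of "(n, u)"]) auto

lemma first_hit_ge: "ennreal a \<le> first_hit a m \<omega>"
  unfolding first_hit_def by (rule INF_greatest) (auto intro: ennreal_leI)

lemma first_hit_incseq: "incseq (\<lambda>m. first_hit a m \<omega>)"
  unfolding incseq_def first_hit_def by (auto intro!: INF_superset_mono)

text \<open>Each barrier is finite at countably many times only, so the strict event
  \<open>first_hit a m \<omega> < r\<close> is a countable union of events observed before
  \<open>r\<close>.\<close>

lemma first_hit_stopping_time:
  assumes a: "0 \<le> a"
  shows "stopping_time (usual_augmentation N F) (first_hit a m)"
proof (rule stopping_time_usual_augmentation[OF filtr])
  fix r
  let ?S = "\<lambda>n. {u. f n u \<noteq> \<infinity>} \<inter> {u. a < u \<and> ennreal u < r}"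
  have "{\<omega>\<in>space N. first_hit a m \<omega> < r}
      = (\<Union>n\<in>{m..}. \<Union>u\<in>?S n. {\<omega>\<in>space N. f n u \<le> ereal (X u \<omega>)})"
    unfolding first_hit_less by auto force
  moreover have "countable (?S n)" for n using sparse by (rule countable_subset[rotated]) auto
  moreover have "{\<omega>\<in>space N. f n u \<le> ereal (X u \<omega>)} \<in> sets (F r)" if "u \<in> ?S n" for n u
  proof -
    have "sets (F (ennreal u)) \<subseteq> sets (F r)"
      using that by (intro filtration.sets_F_mono[OF filtr]) auto
    moreover have "0 \<le> u" using that a by auto
    ultimately show ?thesis using ge_sets by blast
  qed
  ultimately show "{\<omega>\<in>space N. first_hit a m \<omega> < r} \<in> sets (F r)"
    by (auto intro!: sets.countable_UN')
qed

text \<open>Right continuity at \<open>first_hit a m \<omega>\<close> provides a hit close to it in time and in space; it need not be attained.\<close>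

lemma limit_hit:
  assumes a: "0 < a"
  shows "AE \<omega> in N. (\<exists>\<^sub>F n in sequentially. \<omega> \<in> hit n a t) \<longrightarrow>
    first_passage X (boundary_of (gamma_liminf f)) \<omega> \<le> ennreal t"
proof -
  have "AE \<omega> in N. (SUP m. first_hit a m \<omega>) < \<top> \<longrightarrow>
           (\<lambda>m. X (enn2real (first_hit a m \<omega>)) \<omega>) \<longlonglongrightarrow> X (enn2real (SUP m. first_hit a m \<omega>)) \<omega>"
    using left_cont first_hit_stopping_time[OF less_imp_le[OF a]] first_hit_incseq
    unfolding quasi_left_continuous_def by (elim allE[of _ "first_hit a"]) blast
  moreover have "AE \<omega> in N. \<forall>t\<ge>0. continuous (at_right t) (\<lambda>s. X s \<omega>)"
    using right_cont unfolding right_continuous_paths_def .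
  ultimately show ?thesis
  proof (eventually_elim, intro impI)
    fix \<omega>
    assume lc: "(SUP m. first_hit a m \<omega>) < \<top> \<longrightarrow>
           (\<lambda>m. X (enn2real (first_hit a m \<omega>)) \<omega>) \<longlonglongrightarrow> X (enn2real (SUP m. first_hit a m \<omega>)) \<omega>"
      and rc: "\<forall>t\<ge>0. continuous (at_right t) (\<lambda>s. X s \<omega>)"
      and freq: "\<exists>\<^sub>F n in sequentially. \<omega> \<in> hit n a t"
    define \<tau> where "\<tau> m = enn2real (first_hit a m \<omega>)" for m
    define s where "s = enn2real (SUP m. first_hit a m \<omega>)"
    have le_t: "first_hit a m \<omega> \<le> ennreal t" for m
    proof -
      obtain n where "m \<le> n" "\<omega> \<in> hit n a t"
        using freq by (auto simp: frequently_sequentially)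
      then obtain u where "a < u" "u \<le> t" "f n u \<le> ereal (X u \<omega>)" by (auto simp: hit_def)
      then have "first_hit a m \<omega> \<le> ennreal u" using \<open>m \<le> n\<close> by (intro first_hit_le)
      also have "\<dots> \<le> ennreal t" using \<open>u \<le> t\<close> by (rule ennreal_leI)
      finally show ?thesis .
    qed
    then have S_le: "(SUP m. first_hit a m \<omega>) \<le> ennreal t" by (rule SUP_least)
    then have S_fin: "(SUP m. first_hit a m \<omega>) < \<top>" by (rule le_less_trans) simp
    have fin: "first_hit a m \<omega> < \<top>" for m using le_t[of m] by (rule le_less_trans) simp
    have \<tau>: "ennreal (\<tau> m) = first_hit a m \<omega>" for m using fin[of m] by (simp add: \<tau>_def)
    have \<tau>_ge: "a \<le> \<tau> m" for m
      using first_hit_ge[of a m \<omega>] \<tau>[of m] a by (metis \<tau>_def enn2real_nonneg ennreal_le_iff)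
    have s: "ennreal s = (SUP m. first_hit a m \<omega>)" using S_fin by (simp add: s_def)
    have "(\<lambda>m. first_hit a m \<omega>) \<longlonglongrightarrow> ennreal s"
      unfolding s by (rule LIMSEQ_SUP[OF first_hit_incseq])
    then have \<tau>_lim: "\<tau> \<longlonglongrightarrow> s" unfolding \<tau>_def by (rule tendsto_enn2real) (simp add: s_def)
    \<comment> \<open>The limit time is positive and hence counts for \<open>first_passage\<close>;
      this is what the cutoff is for.\<close>
    have s_ge: "a \<le> s" using \<tau>_lim \<tau>_ge by (intro LIMSEQ_le_const) auto
    have X_lim: "(\<lambda>m. X (\<tau> m) \<omega>) \<longlonglongrightarrow> X s \<omega>" using lc S_fin by (simp add: \<tau>_def s_def)
    have "\<exists>n u. m \<le> n \<and> \<tau> m \<le> u \<and> u < \<tau> m + inverse (real (Suc m)) \<and> f n u \<le> ereal (X u \<omega>) \<and>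
        \<bar>X u \<omega> - X (\<tau> m) \<omega>\<bar> < inverse (real (Suc m))" for m
    proof -
      have "continuous (at_right (\<tau> m)) (\<lambda>s. X s \<omega>)" using rc \<tau>_ge[of m] a by auto
      then have "\<forall>\<^sub>F u in at_right (\<tau> m). dist (X u \<omega>) (X (\<tau> m) \<omega>) < inverse (real (Suc m))"
        unfolding continuous_within by (rule tendstoD) simp
      then obtain b where b: "\<tau> m < b" "\<And>u. \<tau> m < u \<Longrightarrow> u < b \<Longrightarrow> dist (X u \<omega>) (X (\<tau> m) \<omega>) < inverse (real (Suc m))"
        unfolding eventually_at_right_field by auto
      have "\<tau> m < min b (\<tau> m + inverse (real (Suc m)))" using b(1) by simp
      then have "first_hit a m \<omega> < ennreal (min b (\<tau> m + inverse (real (Suc m))))"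
        unfolding \<tau>[symmetric] using \<tau>_ge[of m] a by (simp add: ennreal_less_iff)
      then obtain n u where nu: "m \<le> n" "a < u" "f n u \<le> ereal (X u \<omega>)"
          "ennreal u < ennreal (min b (\<tau> m + inverse (real (Suc m))))"
        unfolding first_hit_less by blast
      have "ennreal (\<tau> m) \<le> ennreal u" unfolding \<tau> using nu by (intro first_hit_le)
      then have "\<tau> m \<le> u" using nu a by (simp add: ennreal_le_iff)
      moreover have "u < b" "u < \<tau> m + inverse (real (Suc m))"
        using nu(4) nu(2) a by (simp_all add: ennreal_less_iff)
      moreover have "\<bar>X u \<omega> - X (\<tau> m) \<omega>\<bar> < inverse (real (Suc m))"
        using b(2)[of u] \<open>\<tau> m \<le> u\<close> \<open>u < b\<close> by (cases "u = \<tau> m") (auto simp: dist_real_def)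
      ultimately show ?thesis using nu by blast
    qed
    then obtain n u where nu: "\<And>m. m \<le> n m" "\<And>m. \<tau> m \<le> u m" "\<And>m. u m < \<tau> m + inverse (real (Suc m))"
        "\<And>m. f (n m) (u m) \<le> ereal (X (u m) \<omega>)"
        "\<And>m. \<bar>X (u m) \<omega> - X (\<tau> m) \<omega>\<bar> < inverse (real (Suc m))"
      by metis
    have n_lim: "filterlim n sequentially sequentially"
      by (rule filterlim_at_top_mono[OF filterlim_ident]) (use nu(1) in auto)
    have u_lim: "u \<longlonglongrightarrow> s"
    proof (rule tendsto_sandwich[OF _ _ \<tau>_lim])
      show "(\<lambda>m. \<tau> m + inverse (real (Suc m))) \<longlonglongrightarrow> s"
        using tendsto_add[OF \<tau>_lim LIMSEQ_inverse_real_of_nat] by simp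
    qed (auto intro!: always_eventually nu(2) less_imp_le[OF nu(3)] simp del: of_nat_Suc)
    have "(\<lambda>m. X (u m) \<omega> - X (\<tau> m) \<omega>) \<longlonglongrightarrow> 0"
      by (rule tendsto_rabs_zero_cancel, rule tendsto_sandwich[OF _ _ tendsto_const LIMSEQ_inverse_real_of_nat])
        (auto intro!: always_eventually less_imp_le[OF nu(5)] simp del: of_nat_Suc)
    from tendsto_add[OF this X_lim] have Xu_lim: "(\<lambda>m. X (u m) \<omega>) \<longlonglongrightarrow> X s \<omega>" by simp
    have "gamma_liminf f s \<le> ereal (X s \<omega>)"
      by (rule gamma_liminf_le[OF n_lim u_lim nu(4) Xu_lim])
    then have "first_passage X (boundary_of (gamma_liminf f)) \<omega> \<le> ennreal s"
      unfolding first_passage_def using s_ge a by (intro INF_lower) auto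
    also have "\<dots> \<le> ennreal t" unfolding s by (rule S_le)
    finally show "first_passage X (boundary_of (gamma_liminf f)) \<omega> \<le> ennreal t" .
  qed
qed

text \<open>A version of the strict passage time that inspects countably many fixed times: it is
  measurable and can be estimated at deterministic times.\<close>

definition passage :: "'w \<Rightarrow> ennreal" where
  "passage \<omega> = (INF s\<in>{s\<in>C. 0 < s \<and> gamma_liminf f s < ereal (X s \<omega>)}. ennreal s)"

text \<open>A rational strictly between boundary and path turns a crossing into a countable union of
  events with deterministic time and level, and leaves room for the approximating barriers.\<close>

lemma passage_less:
  "{\<omega>\<in>space N. passage \<omega> < r} = (\<Union>(s, q)\<in>{(s, q). s \<in> C \<and> 0 < s \<and> ennreal s < r \<and> gamma_liminf f s < ereal (of_rat q)}.
     {\<omega>\<in>space N. of_rat q < X s \<omega>})"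
proof safe
  fix \<omega> assume "\<omega> \<in> space N" "passage \<omega> < r"
  then obtain s where s: "s \<in> C" "0 < s" "gamma_liminf f s < ereal (X s \<omega>)" "ennreal s < r"
    unfolding passage_def INF_less_iff by auto
  obtain q where "gamma_liminf f s < ereal (of_rat q)" "ereal (of_rat q) < ereal (X s \<omega>)"
    using ereal_dense3[OF s(3)] by blast
  with s \<open>\<omega> \<in> space N\<close> show "\<omega> \<in> (\<Union>(s, q)\<in>{(s, q). s \<in> C \<and> 0 < s \<and> ennreal s < r \<and> gamma_liminf f s < ereal (of_rat q)}.
     {\<omega>\<in>space N. of_rat q < X s \<omega>})"
    by (auto intro!: bexI[of _ "(s, q)"])
next
  fix \<omega> s q assume s: "s \<in> C" "0 < s" "ennreal s < r" "gamma_liminf f s < ereal (of_rat q)" "of_rat q < X s \<omega>"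
  have "gamma_liminf f s < ereal (X s \<omega>)" by (rule less_trans[OF s(4)]) (use s(5) in simp)
  then have "passage \<omega> \<le> ennreal s" unfolding passage_def using s by (intro INF_lower) auto
  with s(3) show "passage \<omega> < r" by simp
qed

lemma countable_levels: "countable {(s, q). s \<in> C \<and> P s q}" for P :: "real \<Rightarrow> rat \<Rightarrow> bool"
  by (rule countable_subset[of _ "C \<times> UNIV"]) (use C_countable in auto)

lemma gt_events: "0 \<le> s \<Longrightarrow> {\<omega>\<in>space N. c < X s \<omega>} \<in> events"
  using X_measurable[of s] by measurable

lemma passage_measurable: "passage \<in> borel_measurable N"
proof (rule borel_measurableI_less)
  fix r
  show "{\<omega>\<in>space N. passage \<omega> < r} \<in> events"
    unfolding passage_less
    by (rule sets.countable_UN'[OF countable_levels]) (auto intro!: gt_events)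
qed

text \<open>After a strict crossing a right-continuous path stays above some level \<open>q\<close>
  for a while, and in that stretch \<open>C\<close> has a time, possibly the crossing time itself,
  at which the boundary is below \<open>q\<close>.\<close>

lemma strict_first_passage_eq:
  assumes rc: "\<forall>t\<ge>0. continuous (at_right t) (\<lambda>s. X s \<omega>)"
  shows "strict_first_passage X (boundary_of (gamma_liminf f)) \<omega> = passage \<omega>"
proof (rule antisym)
  show "strict_first_passage X (boundary_of (gamma_liminf f)) \<omega> \<le> passage \<omega>"
    unfolding strict_first_passage_def passage_def by (rule INF_superset_mono) auto
  show "passage \<omega> \<le> strict_first_passage X (boundary_of (gamma_liminf f)) \<omega>"
    unfolding strict_first_passage_def
  proof (rule INF_greatest, safe, rule ennreal_le_epsilon)
    fix t and e :: real
    assume t: "0 < t" "boundary_of (gamma_liminf f) (ennreal t) < ereal (X t \<omega>)" and e: "0 < e"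
    then have "gamma_liminf f t < ereal (X t \<omega>)" by simp
    then obtain q where q: "gamma_liminf f t < ereal q" "q < X t \<omega>"
      using ereal_dense2 by force
    have "continuous (at_right t) (\<lambda>s. X s \<omega>)" using rc t by auto
    then have "\<forall>\<^sub>F u in at_right t. q < X u \<omega>"
      unfolding continuous_within using q(2) by (rule order_tendstoD)
    then obtain b where b: "t < b" "\<And>u. t < u \<Longrightarrow> u < b \<Longrightarrow> q < X u \<omega>"
      unfolding eventually_at_right_field by auto
    obtain c where c: "c \<in> C" "t \<le> c" "c < t + min (b - t) e" "gamma_liminf f c < ereal q"
      using C_dense[OF q(1), of "min (b - t) e"] b(1) e by auto
    have "q < X c \<omega>" using b(2)[of c] q(2) c by (cases "c = t") auto
    then have "gamma_liminf f c < ereal (X c \<omega>)" using c(4) by (auto intro: less_trans)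
    then have "passage \<omega> \<le> ennreal c" unfolding passage_def using c t by (intro INF_lower) auto
    also have "\<dots> \<le> ennreal (t + e)" using c by (intro ennreal_leI) auto
    also have "\<dots> = ennreal t + ennreal e" using t e by (intro ennreal_plus) auto
    finally show "passage \<omega> \<le> ennreal t + ennreal e" .
  qed
qed

lemma AE_passage: "AE \<omega> in N. first_passage X (boundary_of (gamma_liminf f)) \<omega> = passage \<omega>"
  using strict right_cont unfolding right_continuous_paths_def
  by eventually_elim (simp add: strict_first_passage_eq)

text \<open>Constants are stopping times, so quasi-left-continuity excludes jumps at fixed
  times.\<close>

lemma AE_tendsto_at_left:
  assumes S: "incseq S" "\<And>n. 0 < S n" "S \<longlonglongrightarrow> s"
  shows "AE \<omega> in N. (\<lambda>n. X (S n) \<omega>) \<longlonglongrightarrow> X s \<omega>"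
proof -
  have pos: "0 \<le> s" using S(2,3) by (intro LIMSEQ_le_const) (auto intro: less_imp_le)
  have inc: "incseq (\<lambda>n. ennreal (S n))" using S(1) by (auto simp: incseq_def intro: ennreal_leI)
  have "(\<lambda>n. ennreal (S n)) \<longlonglongrightarrow> ennreal s" using S(3) by (rule tendsto_ennrealI)
  then have sup: "(SUP n. ennreal (S n)) = ennreal s"
    using LIMSEQ_SUP[OF inc] by (rule LIMSEQ_unique[rotated])
  have "AE \<omega> in N. (SUP n. ennreal (S n)) < \<top> \<longrightarrow>
     (\<lambda>n. X (enn2real (ennreal (S n))) \<omega>) \<longlonglongrightarrow> X (enn2real (SUP n. ennreal (S n))) \<omega>"
    using left_cont stopping_time_const inc unfolding quasi_left_continuous_def
    by (elim allE[of _ "\<lambda>n \<omega>. ennreal (S n)"]) blast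
  then show ?thesis
    unfolding sup using pos S(2) by (simp add: less_imp_le)
qed

lemma AE_tendsto_at_right:
  assumes S: "\<And>n. s < S n" "S \<longlonglongrightarrow> s" and s: "0 \<le> s"
  shows "AE \<omega> in N. (\<lambda>n. X (S n) \<omega>) \<longlonglongrightarrow> X s \<omega>"
  using right_cont unfolding right_continuous_paths_def
proof eventually_elim
  case (elim \<omega>)
  then have "((\<lambda>s. X s \<omega>) \<longlongrightarrow> X s \<omega>) (at_right s)" using s by (simp add: continuous_within)
  moreover have "filterlim S (at_right s) sequentially"
    using S by (rule filterlim_at_right_sequentially)
  ultimately show ?case by (rule filterlim_compose)
qed

text \<open>Continuity in probability at a fixed time, restricted to drops: a path above
  \<open>q\<close> at \<open>s\<close> should still be above \<open>q\<close> at the nearby time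
  \<open>u\<close> where an approximating barrier is low.\<close>

lemma drop_tendsto_0:
  assumes s: "0 < s"
  shows "((\<lambda>u. prob {\<omega>\<in>space N. q < X s \<omega> \<and> X u \<omega> \<le> q}) \<longlongrightarrow> 0) (at s)"
proof -
  have lim: "(\<lambda>n. prob {\<omega>\<in>space N. q < X s \<omega> \<and> X (S n) \<omega> \<le> q}) \<longlonglongrightarrow> 0"
    if S: "\<And>n. 0 \<le> S n" "AE \<omega> in N. (\<lambda>n. X (S n) \<omega>) \<longlonglongrightarrow> X s \<omega>" for S :: "nat \<Rightarrow> real"
  proof -
    note [measurable] = X_measurable[OF S(1)] X_measurable[OF less_imp_le[OF s]]
    let ?V = "\<lambda>n. {\<omega>\<in>space N. q < X s \<omega> \<and> X (S n) \<omega> \<le> q}"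
    have [measurable]: "?V n \<in> events" for n by measurable
    have "(\<lambda>n. \<integral>\<omega>. indicat_real (?V n) \<omega> \<partial>N) \<longlonglongrightarrow> (\<integral>\<omega>. 0 \<partial>N)"
    proof (rule integral_dominated_convergence[where w="\<lambda>_. 1"])
      show "AE \<omega> in N. (\<lambda>n. indicat_real (?V n) \<omega>) \<longlonglongrightarrow> 0"
        using S(2)
      proof eventually_elim
        case (elim \<omega>)
        show ?case
        proof (cases "q < X s \<omega>")
          case True
          from order_tendstoD(1)[OF elim True] have "\<forall>\<^sub>F n in sequentially. indicat_real (?V n) \<omega> = 0"
            by eventually_elim (auto simp: indicator_def)
          then show ?thesis by (rule tendsto_eventually)
        next
          case False
          then show ?thesis by (simp add: indicator_def)
        qed
      qed
    qed (auto simp: indicator_def)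
    then show ?thesis by simp
  qed
  have "((\<lambda>u. prob {\<omega>\<in>space N. q < X s \<omega> \<and> X u \<omega> \<le> q}) \<longlongrightarrow> 0) (at_left s)"
    using s by (rule tendsto_at_left_sequentially) (auto intro!: lim AE_tendsto_at_left intro: less_imp_le)
  moreover have "((\<lambda>u. prob {\<omega>\<in>space N. q < X s \<omega> \<and> X u \<omega> \<le> q}) \<longlongrightarrow> 0) (at_right s)"
    by (rule tendsto_at_right_sequentially[of s "s + 1"])
      (use s in \<open>auto intro!: lim AE_tendsto_at_right intro: less_imp_le order.strict_trans\<close>)
  ultimately show ?thesis by (simp add: filterlim_split_at)
qed

text \<open>For large \<open>n\<close> the barrier lies below \<open>q\<close> at some deterministic
  \<open>u\<close> near \<open>s\<close>. A path above \<open>q\<close> at \<open>s\<close> then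
  either hits the barrier at \<open>u\<close> or drops in between, and drops vanish in probability.
  Finitely many pairs are treated at a time so that the errors can be summed.\<close>

lemma prob_passage_less:
  assumes t: "t \<in> D"
  shows "prob {\<omega>\<in>space N. passage \<omega> < ennreal t} \<le> 1 - G t"
  unfolding passage_less
proof (rule measure_countable_UN_le[OF countable_levels])
  fix J :: "(real \<times> rat) set"
  let ?V = "\<lambda>(s, q). {\<omega>\<in>space N. of_rat q < X s \<omega>}"
  assume J: "finite J" "J \<subseteq> {(s, q). s \<in> C \<and> 0 < s \<and> ennreal s < ennreal t \<and> gamma_liminf f s < ereal (of_rat q)}"
  have V: "?V k \<in> events" if "k \<in> J" for k using J that by (auto intro!: gt_events)
  have h: "hit n 0 t \<in> events" for n by (rule hit_events) simp
  have lim: "(\<lambda>n. prob (?V k - hit n 0 t)) \<longlonglongrightarrow> 0" if k: "k \<in> J" for k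
  proof -
    obtain s q where sq: "k = (s, q)" by (cases k)
    then have s: "0 < s" "s < t" "gamma_liminf f s < ereal (of_rat q)"
      using J(2) k by (auto simp: ennreal_less_iff)
    show ?thesis
    proof (rule LIMSEQ_I, simp)
      fix r :: real assume r: "0 < r"
      have "\<forall>\<^sub>F u in at s. dist (prob {\<omega>\<in>space N. of_rat q < X s \<omega> \<and> X u \<omega> \<le> of_rat q}) 0 < r"
        by (rule tendstoD[OF drop_tendsto_0[OF s(1)] r])
      then obtain d where d: "0 < d" "\<And>u. u \<noteq> s \<Longrightarrow> dist u s < d \<Longrightarrow>
          prob {\<omega>\<in>space N. of_rat q < X s \<omega> \<and> X u \<omega> \<le> of_rat q} < r"
        unfolding eventually_at by auto
      have "\<forall>\<^sub>F n in sequentially. \<exists>u. \<bar>u - s\<bar> < min d (min s (t - s)) \<and> f n u < ereal (of_rat q)"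
        \<comment> \<open>The radius keeps \<open>u\<close> inside \<open>(0, t)\<close>, where a
          hit counts.\<close>
        using s d(1) by (intro recovery) auto
      then have "\<forall>\<^sub>F n in sequentially. prob (?V k - hit n 0 t) < r"
      proof eventually_elim
        case (elim n)
        then obtain u where u: "\<bar>u - s\<bar> < d" "0 < u" "u \<le> t" "f n u < ereal (of_rat q)" by auto
        have "?V k - hit n 0 t \<subseteq> {\<omega>\<in>space N. of_rat q < X s \<omega> \<and> X u \<omega> \<le> of_rat q}"
        proof
          fix \<omega> assume \<omega>: "\<omega> \<in> ?V k - hit n 0 t"
          then have "\<not> f n u \<le> ereal (X u \<omega>)" using u by (auto simp: hit_def sq)
          then have "ereal (X u \<omega>) < f n u" by (simp only: not_le)
          then have "ereal (X u \<omega>) < ereal (of_rat q)" using u(4) by (rule less_trans)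
          with \<omega> show "\<omega> \<in> {\<omega>\<in>space N. of_rat q < X s \<omega> \<and> X u \<omega> \<le> of_rat q}"
            by (simp add: sq)
        qed
        then have le: "prob (?V k - hit n 0 t) \<le> prob {\<omega>\<in>space N. of_rat q < X s \<omega> \<and> X u \<omega> \<le> of_rat q}"
          using X_measurable[of s] X_measurable[of u] s(1) u(2) by (intro finite_measure_mono) auto
        show ?case
        \<comment> \<open>The punctured limit says nothing at \<open>u = s\<close>, but there the
          drop event is empty.\<close>
        proof (cases "u = s")
          case True
          then have "{\<omega>\<in>space N. of_rat q < X s \<omega> \<and> X u \<omega> \<le> of_rat q} = {}" by auto
          with le r show ?thesis by simp
        next
          case False
          with le d(2)[of u] u(1) show ?thesis by (simp add: dist_real_def)
        qed
      qed
      then show "\<exists>no. \<forall>n\<ge>no. prob (?V k - hit n 0 t) < r"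
        by (simp add: eventually_sequentially)
    qed
  qed
  have "(\<lambda>n. (1 - G t) + (\<Sum>k\<in>J. prob (?V k - hit n 0 t))) \<longlonglongrightarrow> (1 - G t) + (\<Sum>k\<in>J. 0)"
    by (intro tendsto_intros lim)
  moreover have "\<forall>\<^sub>F n in sequentially. prob (\<Union>k\<in>J. ?V k) \<le> (1 - G t) + (\<Sum>k\<in>J. prob (?V k - hit n 0 t))"
    using hits[OF t]
  proof eventually_elim
    case (elim n)
    have "prob (\<Union>k\<in>J. ?V k) \<le> prob (hit n 0 t \<union> (\<Union>k\<in>J. ?V k - hit n 0 t))"
      using V h J(1) by (intro finite_measure_mono sets.Un sets.finite_UN sets.Diff) auto
    also have "\<dots> \<le> prob (hit n 0 t) + prob (\<Union>k\<in>J. ?V k - hit n 0 t)"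
      using V h J(1) by (intro measure_Un_le sets.finite_UN sets.Diff) auto
    also have "prob (\<Union>k\<in>J. ?V k - hit n 0 t) \<le> (\<Sum>k\<in>J. prob (?V k - hit n 0 t))"
      using V h J(1) by (intro measure_UNION_le sets.Diff) auto
    finally show ?case using elim by (simp add: hit_def)
  qed
  ultimately show "prob (\<Union>k\<in>J. ?V k) \<le> 1 - G t"
    by (intro tendsto_lowerbound) auto
qed (auto intro!: gt_events)

text \<open>A hit in \<open>(0, t]\<close> without one in \<open>(0, e]\<close> is a hit in
  \<open>(e, t]\<close>. Paths with infinitely many such hits have passed the limit boundary by time
  \<open>t\<close>, because \<open>e > 0\<close> keeps the hits away from time 0.\<close>

lemma prob_passage_le:
  assumes e: "e \<in> D" and t: "t \<in> D" and "e \<le> t"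
  shows "G e - G t \<le> prob {\<omega>\<in>space N. passage \<omega> \<le> ennreal t}"
proof -
  have h: "hit n 0 s \<in> events" "hit n e s \<in> events" for n s
    using D_pos[OF e] by (auto intro!: hit_events)
  have "\<forall>\<^sub>F n in sequentially. G e - G t \<le> prob (hit n e t)"
    using hits[OF e] hits[OF t]
  proof eventually_elim
    case (elim n)
    have "prob (hit n 0 t) \<le> prob (hit n 0 e \<union> hit n e t)"
    proof (rule finite_measure_mono)
      show "hit n 0 t \<subseteq> hit n 0 e \<union> hit n e t"
        unfolding hit_def using not_less by blast
    qed (use h in auto)
    also have "\<dots> \<le> prob (hit n 0 e) + prob (hit n e t)"
      using h by (intro measure_Un_le) auto
    finally show ?case using elim by (simp add: hit_def)
  qed
  then have "G e - G t \<le> prob (\<Inter>m. \<Union>n\<in>{m..}. hit n e t)"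
    using h by (intro measure_INT_UN_ge)
  also have "\<dots> \<le> prob {\<omega>\<in>space N. passage \<omega> \<le> ennreal t}"
  proof (rule finite_measure_mono_AE)
    show "AE \<omega> in N. \<omega> \<in> (\<Inter>m. \<Union>n\<in>{m..}. hit n e t) \<longrightarrow> \<omega> \<in> {\<omega>\<in>space N. passage \<omega> \<le> ennreal t}"
      using limit_hit[OF D_pos[OF e], of t] AE_passage
    proof eventually_elim
      case (elim \<omega>)
      show ?case
      proof
        assume \<omega>: "\<omega> \<in> (\<Inter>m. \<Union>n\<in>{m..}. hit n e t)"
        then have "\<exists>\<^sub>F n in sequentially. \<omega> \<in> hit n e t"
          unfolding frequently_sequentially by auto
        moreover have "\<omega> \<in> space N" using \<omega> by (auto simp: hit_def)
        ultimately show "\<omega> \<in> {\<omega>\<in>space N. passage \<omega> \<le> ennreal t}" using elim by auto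
      qed
    qed
    show "{\<omega>\<in>space N. passage \<omega> \<le> ennreal t} \<in> events"
      using passage_measurable by measurable
  qed
  finally show ?thesis .
qed

text \<open>The bounds at times of \<open>D\<close> extend to every \<open>t\<close> by
  right-continuity of both sides; the cutoff is sent to 0, where \<open>G 0 = 1\<close>.\<close>

lemma prob_passage:
  assumes t: "0 \<le> t"
  shows "prob {\<omega>\<in>space N. passage \<omega> \<le> ennreal t} = 1 - G t"
proof -
  note [measurable] = passage_measurable
  have "\<exists>d. (\<forall>n::nat. d n \<in> D \<and> s < d n) \<and> d \<longlonglongrightarrow> s" if "0 \<le> s" for s
  proof -
    have "\<exists>d. d \<in> D \<and> s < d \<and> d < s + inverse (real (Suc n))" for n
      using D_dense[OF that, of "inverse (real (Suc n))"] by auto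
    then obtain d where d: "\<And>n. d n \<in> D" "\<And>n. s < d n" "\<And>n. d n < s + inverse (real (Suc n))" by metis
    have "d \<longlonglongrightarrow> s"
    proof (rule tendsto_sandwich[OF _ _ tendsto_const])
      show "(\<lambda>n. s + inverse (real (Suc n))) \<longlonglongrightarrow> s"
        using tendsto_add[OF tendsto_const LIMSEQ_inverse_real_of_nat, of s] by simp
    qed (auto intro!: always_eventually less_imp_le[OF d(2)] less_imp_le[OF d(3)] simp del: of_nat_Suc)
    with d show ?thesis by blast
  qed
  note approx = this
  have G_lim: "(\<lambda>n. G (d n)) \<longlonglongrightarrow> G s" if "0 \<le> s" "\<And>n::nat. s < d n" "d \<longlonglongrightarrow> s" for s d
    by (rule filterlim_compose[OF G_right[OF that(1)]]) (rule filterlim_at_right_sequentially[OF that(2,3)])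
  obtain d where d: "\<And>n::nat. d n \<in> D" "\<And>n. t < d n" "d \<longlonglongrightarrow> t" using approx[OF t] by blast
  obtain e where e: "\<And>n::nat. e n \<in> D" "\<And>n. 0 < e n" "e \<longlonglongrightarrow> 0" using approx[of 0] by auto
  have upper: "prob {\<omega>\<in>space N. passage \<omega> \<le> ennreal t} \<le> 1 - G t"
  proof (rule LIMSEQ_le_const)
    show "(\<lambda>n. 1 - G (d n)) \<longlonglongrightarrow> 1 - G t"
      by (intro tendsto_intros G_lim) (use t d in auto)
    have "prob {\<omega>\<in>space N. passage \<omega> \<le> ennreal t} \<le> 1 - G (d n)" for n
    proof -
      have "prob {\<omega>\<in>space N. passage \<omega> \<le> ennreal t} \<le> prob {\<omega>\<in>space N. passage \<omega> < ennreal (d n)}"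
        using d(2)[of n] t by (intro finite_measure_mono) (auto simp: ennreal_less_iff intro: le_less_trans)
      also have "\<dots> \<le> 1 - G (d n)" by (rule prob_passage_less[OF d(1)])
      finally show ?thesis .
    qed
    then show "\<exists>N'. \<forall>n\<ge>N'. prob {\<omega>\<in>space N. passage \<omega> \<le> ennreal t} \<le> 1 - G (d n)" by blast
  qed
  have lower_D: "1 - G c \<le> prob {\<omega>\<in>space N. passage \<omega> \<le> ennreal c}" if c: "c \<in> D" for c
  proof (rule tendsto_upperbound)
    show "(\<lambda>n. G (e n) - G c) \<longlonglongrightarrow> 1 - G c"
      using G_lim[of 0 e] e G_0 by (intro tendsto_intros) auto
    have "\<forall>\<^sub>F n in sequentially. e n < c" using e(3) D_pos[OF c] by (rule order_tendstoD)
    then show "\<forall>\<^sub>F n in sequentially. G (e n) - G c \<le> prob {\<omega>\<in>space N. passage \<omega> \<le> ennreal c}"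
      by eventually_elim (use e c in \<open>auto intro!: prob_passage_le\<close>)
  qed simp
  \<comment> \<open>Running minima make the times decrease without leaving \<open>D\<close>, as
    continuity from above requires.\<close>
  define r where "r n = Min (d ` {..n})" for n
  have r: "r n \<in> D" "t < r n" "r n \<le> d n" for n
  proof -
    have "r n \<in> d ` {..n}" unfolding r_def by (rule Min_in) auto
    then show "r n \<in> D" "t < r n" using d by auto
    show "r n \<le> d n" unfolding r_def by (rule Min_le) auto
  qed
  have r_dec: "decseq r"
    unfolding decseq_def r_def by (auto intro!: Min_antimono)
  have r_lim: "r \<longlonglongrightarrow> t"
    by (rule tendsto_sandwich[OF _ _ tendsto_const d(3)]) (auto intro!: always_eventually less_imp_le[OF r(2)] r(3))
  have "(\<lambda>n. prob {\<omega>\<in>space N. passage \<omega> \<le> ennreal (r n)})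
      \<longlonglongrightarrow> prob (\<Inter>n. {\<omega>\<in>space N. passage \<omega> \<le> ennreal (r n)})"
    using r_dec by (intro finite_Lim_measure_decseq) (auto simp: decseq_def intro: order_trans[OF _ ennreal_leI])
  moreover have "(\<Inter>n. {\<omega>\<in>space N. passage \<omega> \<le> ennreal (r n)}) = {\<omega>\<in>space N. passage \<omega> \<le> ennreal t}"
  proof safe
    fix \<omega> assume "\<omega> \<in> (\<Inter>n. {\<omega>\<in>space N. passage \<omega> \<le> ennreal (r n)})"
    then show "passage \<omega> \<le> ennreal t"
      by (intro LIMSEQ_le_const[OF tendsto_ennrealI[OF r_lim]]) auto
  next
    fix \<omega> n assume "passage \<omega> \<le> ennreal t"
    also have "ennreal t \<le> ennreal (r n)" using r(2)[of n] by (intro ennreal_leI) simp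
    finally show "passage \<omega> \<le> ennreal (r n)" .
  qed auto
  ultimately have lim1: "(\<lambda>n. prob {\<omega>\<in>space N. passage \<omega> \<le> ennreal (r n)}) \<longlonglongrightarrow> prob {\<omega>\<in>space N. passage \<omega> \<le> ennreal t}"
    by simp
  have lim2: "(\<lambda>n. 1 - G (r n)) \<longlonglongrightarrow> 1 - G t"
    by (intro tendsto_intros G_lim) (use t r r_lim in auto)
  have "1 - G t \<le> prob {\<omega>\<in>space N. passage \<omega> \<le> ennreal t}"
    by (rule LIMSEQ_le[OF lim2 lim1]) (use lower_D r in auto)
  with upper show ?thesis by simp
qed

lemma first_passage_measurable:
  "first_passage X (boundary_of (gamma_liminf f)) \<in> borel_measurable (completion N)"
proof -
  have "passage \<in> borel_measurable (completion N)"
    using passage_measurable by (rule measurable_completion)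
  moreover have "AE \<omega> in completion N. passage \<omega> = first_passage X (boundary_of (gamma_liminf f)) \<omega>"
    using AE_completion[OF AE_passage] by eventually_elim simp
  ultimately show ?thesis
    by (rule measurable_completion_AE_eq) simp
qed

lemma distr_first_passage:
  "distr (completion N) borel (first_passage X (boundary_of (gamma_liminf f))) = distr N borel passage"
proof -
  have "distr (completion N) borel (first_passage X (boundary_of (gamma_liminf f))) = distr (completion N) borel passage"
    using first_passage_measurable passage_measurable AE_passage
    by (intro distr_cong_AE) (auto simp: AE_completion_iff measurable_completion)
  then show ?thesis using passage_measurable by (simp add: distr_completion)
qed

end

lemma distr_ennreal_eqI:
  fixes Y :: "'a \<Rightarrow> ennreal" and Z :: "'b \<Rightarrow> ennreal"
  assumes "prob_space M" "prob_space N"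
    and Y [measurable]: "Y \<in> borel_measurable M" and Z [measurable]: "Z \<in> borel_measurable N"
    and eq: "\<And>t. 0 \<le> t \<Longrightarrow> measure M {\<omega>\<in>space M. Y \<omega> \<le> ennreal t} = measure N {\<omega>\<in>space N. Z \<omega> \<le> ennreal t}"
  shows "distr M borel Y = distr N borel Z"
proof -
  interpret M: prob_space M by fact
  interpret N: prob_space N by fact
  interpret Y: prob_space "distr M borel Y" by (rule M.prob_space_distr) simp
  interpret Z: prob_space "distr N borel Z" by (rule N.prob_space_distr) simp
  \<comment> \<open>No ray contains 0, so \<open>UNIV\<close> is added to the generator in order to
    cover the space.\<close>
  let ?E = "insert UNIV (range greaterThan :: ennreal set set)"
  show ?thesis
  proof (rule measure_eqI_generator_eq[where E="?E" and \<Omega>=UNIV and A="\<lambda>_. UNIV"])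
    have "{a<..} \<inter> {b<..} = {max a b<..}" for a b :: ennreal by auto
    then show "Int_stable ?E" by (auto simp: Int_stable_def simp del: greaterThan_Int_greaterThan)
    have "sigma_sets UNIV ?E = sigma_sets UNIV (range greaterThan :: ennreal set set)"
      by (rule sigma_sets_eqI) (auto intro: sigma_sets_top)
    then have "sets (borel :: ennreal measure) = sigma_sets UNIV ?E"
      by (simp add: borel_Ioi)
    then show "sets (distr M borel Y) = sigma_sets UNIV ?E" "sets (distr N borel Z) = sigma_sets UNIV ?E"
      by simp_all
    fix A assume "A \<in> ?E"
    then consider "A = UNIV" | "A = {\<top><..}" | t where "0 \<le> t" "A = {ennreal t<..}"
      by (auto elim!: ennreal_cases)
    then show "emeasure (distr M borel Y) A = emeasure (distr N borel Z) A"
    proof cases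
      case 1
      then show ?thesis using Y.emeasure_space_1 Z.emeasure_space_1 by simp
    next
      case 2
      then have "A = {}" by auto
      then show ?thesis by simp
    next
      case 3
      have "Y -` A \<inter> space M = space M - {\<omega>\<in>space M. Y \<omega> \<le> ennreal t}"
        "Z -` A \<inter> space N = space N - {\<omega>\<in>space N. Z \<omega> \<le> ennreal t}"
        using 3 by auto
      then show ?thesis
        using 3 eq[OF 3(1)]
        by (simp add: emeasure_distr M.emeasure_eq_measure N.emeasure_eq_measure M.prob_compl N.prob_compl)
    qed
  qed (use Y.emeasure_finite in auto)
qed

section \<open>Survival functions and dyadic grids\<close>

definition survival :: "'a measure \<Rightarrow> ('a \<Rightarrow> real) \<Rightarrow> real \<Rightarrow> real" where
  "survival N \<xi> t = \<P>(\<omega> in N. t < \<xi> \<omega>)"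

context
  fixes N :: "'a measure" and \<xi> :: "'a \<Rightarrow> real"
  assumes N: "prob_space N" and \<xi>: "\<xi> \<in> borel_measurable N"
begin

interpretation prob_space N by (rule N)

lemma survival_events [measurable]: "{\<omega>\<in>space N. t < \<xi> \<omega>} \<in> events"
  using \<xi> by measurable

lemma survival_antimono: "antimono (survival N \<xi>)"
  unfolding survival_def by (intro antimonoI finite_measure_mono) auto

lemma survival_nonneg: "0 \<le> survival N \<xi> t"
  by (simp add: survival_def)

lemma survival_0: "(\<And>a. a \<in> space N \<Longrightarrow> 0 < \<xi> a) \<Longrightarrow> survival N \<xi> 0 = 1"
proof -
  assume "\<And>a. a \<in> space N \<Longrightarrow> 0 < \<xi> a"
  then have "{\<omega>\<in>space N. 0 < \<xi> \<omega>} = space N" by auto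
  then show ?thesis by (simp add: survival_def prob_space)
qed

lemma survival_right_cont: "(survival N \<xi> \<longlongrightarrow> survival N \<xi> t) (at_right t)"
proof (rule tendsto_at_right_sequentially[of t "t + 1"])
  fix S :: "nat \<Rightarrow> real"
  assume S: "\<And>n. t < S n" "decseq S" "S \<longlonglongrightarrow> t"
  have "(\<lambda>n. prob {\<omega>\<in>space N. S n < \<xi> \<omega>}) \<longlonglongrightarrow> prob (\<Union>n. {\<omega>\<in>space N. S n < \<xi> \<omega>})"
    using S(2) by (intro finite_Lim_measure_incseq) (auto simp: incseq_def decseq_def intro: le_less_trans)
  moreover have "(\<Union>n. {\<omega>\<in>space N. S n < \<xi> \<omega>}) = {\<omega>\<in>space N. t < \<xi> \<omega>}"
  proof safe
    fix \<omega> n assume "S n < \<xi> \<omega>" then show "t < \<xi> \<omega>" using S(1)[of n] by simp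
  next
    fix \<omega> assume \<omega>: "\<omega> \<in> space N" "t < \<xi> \<omega>"
    have "\<forall>\<^sub>F n in sequentially. S n < \<xi> \<omega>" using S(3) \<omega>(2) by (rule order_tendstoD)
    then obtain n where "S n < \<xi> \<omega>" by (auto simp: eventually_sequentially)
    with \<omega>(1) show "\<omega> \<in> (\<Union>n. {\<omega>\<in>space N. S n < \<xi> \<omega>})" by auto
  qed
  ultimately show "(\<lambda>n. survival N \<xi> (S n)) \<longlonglongrightarrow> survival N \<xi> t"
    by (simp add: survival_def)
qed simp

lemma survival_pos_right: "0 < survival N \<xi> t \<Longrightarrow> \<exists>s>t. 0 < survival N \<xi> s"
proof -
  assume "0 < survival N \<xi> t"
  then have "\<forall>\<^sub>F s in at_right t. 0 < survival N \<xi> s"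
    by (rule order_tendstoD(1)[OF survival_right_cont])
  then obtain b where "t < b" "\<forall>s>t. s < b \<longrightarrow> 0 < survival N \<xi> s"
    unfolding eventually_at_right_field by auto
  then show ?thesis using dense[of t b] by auto
qed

text \<open>Right-continuity gives a later time with positive survival, hence a strict inequality
  with the supremum. With the converse below, the domain of the hazard ratio is exactly where its
  denominator is positive.\<close>

lemma less_survival_end:
  assumes "0 \<le> t" "0 < survival N \<xi> t" shows "ereal t < survival_end N \<xi>"
proof -
  obtain s where "t < s" "0 < survival N \<xi> s" using survival_pos_right[OF assms(2)] by blast
  then show ?thesis
    unfolding survival_end_def less_SUP_iff using assms(1)
    by (intro bexI[of _ s]) (auto simp: survival_def)
qed

lemma survival_pos_of_less_end: "ereal t < survival_end N \<xi> \<Longrightarrow> 0 < survival N \<xi> t"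
proof -
  assume "ereal t < survival_end N \<xi>"
  then obtain s where "t < s" "0 < survival N \<xi> s"
    unfolding survival_end_def less_SUP_iff by (auto simp: survival_def)
  then show ?thesis
    using antimonoD[OF survival_antimono, of t s] by simp
qed

lemma prob_le_survival: "prob {\<omega>\<in>space N. \<xi> \<omega> \<le> t} = 1 - survival N \<xi> t"
proof -
  have "{\<omega>\<in>space N. \<xi> \<omega> \<le> t} = space N - {\<omega>\<in>space N. t < \<xi> \<omega>}" by auto
  then show ?thesis by (simp add: prob_compl survival_def)
qed

end

text \<open>The monotone ratio is multiplied out so that it remains meaningful past the end of the
  second survival function. There both sides vanish, by the comparison of the two ends in
  \<open>hr_le\<close>.\<close>

lemma hr_le_survival:
  assumes N1: "prob_space N1" "\<xi>1 \<in> borel_measurable N1" and N2: "prob_space N2" "\<xi>2 \<in> borel_measurable N2"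
    and hr: "hr_le N1 \<xi>1 N2 \<xi>2"
  shows "0 \<le> t \<Longrightarrow> survival N2 \<xi>2 t = 0 \<Longrightarrow> survival N1 \<xi>1 t = 0"
    and "0 \<le> s \<Longrightarrow> s \<le> t \<Longrightarrow> survival N1 \<xi>1 t * survival N2 \<xi>2 s \<le> survival N1 \<xi>1 s * survival N2 \<xi>2 t"
proof -
  have le: "survival_end N1 \<xi>1 \<le> survival_end N2 \<xi>2"
    and anti: "antimono_on {t. 0 \<le> t \<and> ereal t < survival_end N2 \<xi>2} (\<lambda>t. survival N1 \<xi>1 t / survival N2 \<xi>2 t)"
    using hr by (simp_all add: hr_le_def Let_def survival_def)
  show zero: "survival N1 \<xi>1 t = 0" if t: "0 \<le> t" "survival N2 \<xi>2 t = 0" for t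
  proof (rule ccontr)
    assume "survival N1 \<xi>1 t \<noteq> 0"
    then have "0 < survival N1 \<xi>1 t" using survival_nonneg[OF N1, of t] by simp
    then have "ereal t < survival_end N2 \<xi>2"
      using less_survival_end[OF N1 t(1)] le by (blast intro: less_le_trans)
    then show False using survival_pos_of_less_end[OF N2] t(2) by fastforce
  qed
  show "survival N1 \<xi>1 t * survival N2 \<xi>2 s \<le> survival N1 \<xi>1 s * survival N2 \<xi>2 t" if st: "0 \<le> s" "s \<le> t"
  proof (cases "survival N2 \<xi>2 t = 0")
    case True
    then show ?thesis using zero[of t] st by simp
  next
    case False
    then have t: "0 < survival N2 \<xi>2 t" using survival_nonneg[OF N2, of t] by simp
    then have s: "0 < survival N2 \<xi>2 s" using antimonoD[OF survival_antimono[OF N2] st(2)] by simp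
    have "survival N1 \<xi>1 t / survival N2 \<xi>2 t \<le> survival N1 \<xi>1 s / survival N2 \<xi>2 s"
      using anti st less_survival_end[OF N2 _ t] less_survival_end[OF N2 _ s]
      by (auto simp: monotone_on_def)
    then show ?thesis using t s by (simp add: field_simps)
  qed
qed

definition on_grid :: "real \<Rightarrow> (nat \<Rightarrow> ereal) \<Rightarrow> real \<Rightarrow> ereal" where
  "on_grid h b u = (if \<exists>k\<ge>1. u = real k * h then b (THE k. u = real k * h) else \<infinity>)"

lemma on_grid_eq: "0 < h \<Longrightarrow> 1 \<le> k \<Longrightarrow> on_grid h b (real k * h) = b k"
  by (auto simp: on_grid_def intro!: arg_cong[where f=b] the_equality)

lemma on_grid_infinity: "on_grid h b u \<noteq> \<infinity> \<Longrightarrow> \<exists>k\<ge>1. u = real k * h"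
  by (auto simp: on_grid_def split: if_splits)

lemma countable_on_grid: "countable {u. on_grid h b u \<noteq> \<infinity>}"
  by (rule countable_subset[of _ "range (\<lambda>k. real k * h)"]) (auto dest: on_grid_infinity)

lemma on_grid_mono:
  assumes h: "0 < h" and le: "\<And>k. b (Suc k) \<le> b' (Suc k)"
  shows "on_grid h b u \<le> on_grid h b' u"
proof (cases "\<exists>k\<ge>1. u = real k * h")
  case True
  then obtain k where "u = real (Suc k) * h"
    by (metis Suc_le_D One_nat_def)
  then show ?thesis using le[of k] on_grid_eq[OF h, of "Suc k"] by simp
qed (auto simp: on_grid_def)

definition dyadics :: "real set" where
  "dyadics = {real m * (1 / 2 ^ j) | m j. 1 \<le> m}"

lemma dyadics_pos: "t \<in> dyadics \<Longrightarrow> 0 < t"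
  by (auto simp: dyadics_def)

lemma dyadics_dense:
  assumes "0 \<le> t" "0 < \<delta>" shows "\<exists>d\<in>dyadics. t < d \<and> d < t + \<delta>"
proof -
  obtain j where j: "(1 / 2) ^ j < \<delta>" using real_arch_pow_inv[OF assms(2), of "1/2"] by auto
  define m where "m = Suc (nat \<lfloor>t * 2 ^ j\<rfloor>)"
  have m: "t * 2 ^ j < real m" "real m \<le> t * 2 ^ j + 1"
    using assms(1) by (simp_all add: m_def) linarith+
  have "t < real m * (1 / 2 ^ j)" using m(1) by (simp add: field_simps)
  moreover have "real m * (1 / 2 ^ j) \<le> t + (1 / 2) ^ j"
    using m(2) by (simp add: field_simps power_one_over)
  moreover have "real m * (1 / 2 ^ j) \<in> dyadics" unfolding dyadics_def m_def by force
  ultimately show ?thesis using j by (intro bexI[of _ "real m * (1 / 2 ^ j)"]) auto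
qed

text \<open>Dyadic grids are nested, so a dyadic time belongs to every sufficiently fine one and its
  hitting probability needs no interpolation.\<close>

lemma dyadics_on_grid:
  assumes t: "t \<in> dyadics" and r: "strict_mono r"
  shows "\<forall>\<^sub>F n in sequentially. \<exists>k\<ge>1. t = real k * (1 / 2 ^ (r n :: nat))"
proof -
  obtain m j where mj: "1 \<le> m" "t = real m * (1 / 2 ^ j)" using t by (auto simp: dyadics_def)
  have "\<exists>k\<ge>1. t = real k * (1 / 2 ^ r n)" if "j \<le> n" for n
  proof (intro exI conjI)
    have "j \<le> r n" using that seq_suble[OF r, of n] by simp
    then have "(2::real) ^ r n = 2 ^ (r n - j) * 2 ^ j" by (simp add: power_add[symmetric])
    then show "t = real (m * 2 ^ (r n - j)) * (1 / 2 ^ r n)" using mj(2) by simp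
  qed (use mj(1) in simp)
  then show ?thesis by (auto simp: eventually_sequentially)
qed

section \<open>Existence and comparison of boundaries\<close>

context markov_family
begin

definition grid_boundary :: "real measure \<Rightarrow> (real \<Rightarrow> real) \<Rightarrow> nat \<Rightarrow> real \<Rightarrow> ereal" where
  "grid_boundary \<mu> G n = on_grid (1 / 2 ^ n)
     (barrier (Q \<mu>) (\<lambda>k. X (real k * (1 / 2 ^ n))) (\<lambda>k. G (real k * (1 / 2 ^ n))))"

text \<open>The barrier is infinite between grid points, so having no hit up to \<open>t\<close> is
  the same as surviving the first \<open>m\<close> steps.\<close>

lemma measure_grid_hit:
  assumes \<mu>: "law_on_E \<mu>" and diff: "\<And>t. 0 < t \<Longrightarrow> diffuse (distr (Q \<mu>) borel (X t))"
    and G: "G 0 = 1" "antimono G" "\<And>t. 0 \<le> G t"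
    and t: "1 \<le> m" "t = real m * (1 / 2 ^ n)"
  shows "measure (Q \<mu>) {\<omega>\<in>space (Q \<mu>). \<exists>u. 0 < u \<and> u \<le> t \<and> grid_boundary \<mu> G n u \<le> ereal (X u \<omega>)} = 1 - G t"
proof -
  interpret prob_space "Q \<mu>" by (rule prob_Q[OF \<mu>])
  define h :: real where "h = 1 / 2 ^ n"
  have h: "0 < h" by (simp add: h_def)
  let ?Y = "\<lambda>k. X (real k * h)" and ?g = "\<lambda>k. G (real k * h)"
  let ?S = "survivors (Q \<mu>) ?Y ?g m"
  have Y: "?Y k \<in> borel_measurable (Q \<mu>)" for k
    using X_measurable_PA[of "real k * h"] h by (simp add: measurable_cong_sets[OF sets_Q[OF \<mu>] refl])
  have "measure (Q \<mu>) ?S = ?g m"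
  proof (rule measure_survivors[OF prob_Q[OF \<mu>] Y])
    show "antimono ?g" using h by (intro antimonoI antimonoD[OF G(2)]) (simp add: mult_right_mono)
  qed (use h in \<open>auto intro!: diff simp: G\<close>)
  moreover have S: "?S \<in> events" by (rule survivors_sets) (use Y in auto)
  moreover have "{\<omega>\<in>space (Q \<mu>). \<exists>u. 0 < u \<and> u \<le> t \<and> grid_boundary \<mu> G n u \<le> ereal (X u \<omega>)} = space (Q \<mu>) - ?S"
  proof safe
    fix \<omega> u assume u: "u \<le> t" "grid_boundary \<mu> G n u \<le> ereal (X u \<omega>)" and \<omega>: "\<omega> \<in> ?S"
    then have "grid_boundary \<mu> G n u \<noteq> \<infinity>" by auto
    then obtain k where k: "1 \<le> k" "u = real k * h"
      using on_grid_infinity unfolding grid_boundary_def h_def by blast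
    have "real k * h \<le> real m * h" using u(1) t(2) k(2) by (simp add: h_def)
    then have "k \<le> m" using h by simp
    then have "ereal (X u \<omega>) < barrier (Q \<mu>) ?Y ?g k"
      using \<omega> k by (simp add: survivors_eq)
    also have "\<dots> = grid_boundary \<mu> G n u"
      unfolding grid_boundary_def k(2) h_def[symmetric] by (rule on_grid_eq[OF h k(1), symmetric])
    finally show False using u(2) by simp
  next
    fix \<omega> assume "\<omega> \<in> space (Q \<mu>)" "\<omega> \<notin> ?S"
    then obtain k where k: "1 \<le> k" "k \<le> m" "barrier (Q \<mu>) ?Y ?g k \<le> ereal (X (real k * h) \<omega>)"
      by (auto simp: survivors_eq not_less)
    have "grid_boundary \<mu> G n (real k * h) = barrier (Q \<mu>) ?Y ?g k"
      unfolding grid_boundary_def h_def[symmetric] by (rule on_grid_eq[OF h k(1)])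
    with k show "\<exists>u. 0 < u \<and> u \<le> t \<and> grid_boundary \<mu> G n u \<le> ereal (X u \<omega>)"
      using h t(2) by (intro exI[of _ "real k * h"]) (auto simp: h_def[symmetric])
  qed
  ultimately show ?thesis
    using t(2) by (simp add: prob_compl h_def)
qed

text \<open>The subsequence \<open>r\<close> is supplied from outside because both laws must share
  it for their boundaries to be comparable; what it has to achieve is
  \<open>recovery\<close>.\<close>

lemma first_passage_limit:
  fixes N :: "'a measure" and \<xi> :: "'a \<Rightarrow> real"
  assumes \<mu>: "law_on_E \<mu>" and diff: "\<And>t. 0 < t \<Longrightarrow> diffuse (distr (Q \<mu>) borel (X t))"
    and rc: "right_continuous_paths (Q \<mu>) X"
    and lc: "quasi_left_continuous (Q \<mu>) (usual_augmentation (Q \<mu>) F) X"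
    and strict: "\<And>b. boundary_function b \<Longrightarrow> AE \<omega> in Q \<mu>. first_passage X b \<omega> = strict_first_passage X b \<omega>"
    and \<xi>: "prob_space N" "\<xi> \<in> borel_measurable N" "\<And>a. a \<in> space N \<Longrightarrow> 0 < \<xi> a"
    and r: "strict_mono r"
    and f: "f = (\<lambda>n. grid_boundary \<mu> (survival N \<xi>) (r n))"
    and recovery: "\<And>t q \<delta>. gamma_liminf f t < q \<Longrightarrow> 0 < \<delta> \<Longrightarrow>
        \<forall>\<^sub>F n in sequentially. \<exists>u. \<bar>u - t\<bar> < \<delta> \<and> f n u < q"
  shows "first_passage X (boundary_of (gamma_liminf f)) \<in> borel_measurable (completion (Q \<mu>))"
    and "distr (completion (Q \<mu>)) borel (first_passage X (boundary_of (gamma_liminf f)))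
      = distr N borel (\<lambda>a. ennreal (\<xi> a))"
proof -
  obtain C where C: "countable C" "\<And>s q h. gamma_liminf f s < q \<Longrightarrow> 0 < h \<Longrightarrow>
        \<exists>c\<in>C. s \<le> c \<and> c < s + h \<and> gamma_liminf f c < q"
    using countable_right_approximation[of "gamma_liminf f"] by blast
  interpret Q: prob_space "Q \<mu>" by (rule prob_Q[OF \<mu>])
  interpret passage_limit "Q \<mu>" X F f "survival N \<xi>" dyadics C
  proof
    show "space (F i) = space (Q \<mu>)" "i \<le> j \<Longrightarrow> sets (F i) \<subseteq> sets (F j)" for i j
      using filtration.space_F[OF filtr] filtration.sets_F_mono[OF filtr] by (simp_all add: space_Q[OF \<mu>])
    show "X t \<in> borel_measurable (Q \<mu>)" if "0 \<le> t" for t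
      using X_measurable_PA[OF that] by (simp add: measurable_cong_sets[OF sets_Q[OF \<mu>] refl])
    show "AE \<omega> in Q \<mu>. first_passage X (boundary_of (gamma_liminf f)) \<omega>
        = strict_first_passage X (boundary_of (gamma_liminf f)) \<omega>"
      by (rule strict[OF boundary_function_gamma_liminf])
    show "countable {u. f n u \<noteq> \<infinity>}" for n
      unfolding f grid_boundary_def by (rule countable_on_grid)
    show "\<forall>\<^sub>F n in sequentially. measure (Q \<mu>)
        {\<omega>\<in>space (Q \<mu>). \<exists>u. 0 < u \<and> u \<le> t \<and> f n u \<le> ereal (X u \<omega>)} = 1 - survival N \<xi> t"
      if "t \<in> dyadics" for t
      using dyadics_on_grid[OF that r]
    proof eventually_elim
      case (elim n)
      then obtain m where m: "1 \<le> m" "t = real m * (1 / 2 ^ r n)" by blast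
      show ?case
        unfolding f
        by (rule measure_grid_hit[OF \<mu> diff survival_0[OF \<xi>] survival_antimono[OF \<xi>(1,2)] survival_nonneg[OF \<xi>(1,2)] m])
    qed
    show "survival N \<xi> 0 = 1" by (rule survival_0[OF \<xi>])
    show "(survival N \<xi> \<longlongrightarrow> survival N \<xi> t) (at_right t)" for t
      by (rule survival_right_cont[OF \<xi>(1,2)])
  qed (fact adapted rc lc recovery dyadics_pos dyadics_dense C)+
  show "first_passage X (boundary_of (gamma_liminf f)) \<in> borel_measurable (completion (Q \<mu>))"
    by (rule first_passage_measurable)
  show "distr (completion (Q \<mu>)) borel (first_passage X (boundary_of (gamma_liminf f)))
      = distr N borel (\<lambda>a. ennreal (\<xi> a))"
    unfolding distr_first_passage
  proof (rule distr_ennreal_eqI[OF Q.prob_space_axioms \<xi>(1) passage_measurable])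
    show "(\<lambda>a. ennreal (\<xi> a)) \<in> borel_measurable N" using \<xi>(2) by measurable
    fix t :: real assume t: "0 \<le> t"
    have "{a\<in>space N. ennreal (\<xi> a) \<le> ennreal t} = {a\<in>space N. \<xi> a \<le> t}"
      using t by (auto simp: ennreal_le_iff)
    then show "Q.prob {\<omega>\<in>space (Q \<mu>). passage \<omega> \<le> ennreal t} = measure N {a\<in>space N. ennreal (\<xi> a) \<le> ennreal t}"
      by (simp add: prob_passage[OF t] prob_le_survival[OF \<xi>(1,2)])
  qed
qed

end

theorem theorem2p11:
  fixes M :: "'w measure" and E :: "real set"
    and X :: "real \<Rightarrow> 'w \<Rightarrow> real" and F :: "ennreal \<Rightarrow> 'w measure"
    and P :: "real \<Rightarrow> 'w measure" and \<mu>1 \<mu>2 :: "real measure"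
    and N1 :: "'a measure" and \<xi>1 :: "'a \<Rightarrow> real"
    and N2 :: "'b measure" and \<xi>2 :: "'b \<Rightarrow> real"
  defines "Q \<equiv> start_law (space M) X P"
  assumes E: "is_interval E"
    and F: "filtration (space M) F" "\<And>t. subalgebra M (F t)"
    and adapted: "\<And>t. 0 \<le> t \<Longrightarrow> X t \<in> borel_measurable (F (ennreal t))"
    and \<mu>: "prob_space \<mu>1" "sets \<mu>1 = sets (restrict_space borel E)"
           "prob_space \<mu>2" "sets \<mu>2 = sets (restrict_space borel E)"
    and st: "\<mu>1 \<preceq>st \<mu>2"
    and \<xi>1: "prob_space N1" "\<xi>1 \<in> borel_measurable N1" "\<And>a. a \<in> space N1 \<Longrightarrow> 0 < \<xi>1 a"
    and \<xi>2: "prob_space N2" "\<xi>2 \<in> borel_measurable N2" "\<And>a. a \<in> space N2 \<Longrightarrow> 0 < \<xi>2 a"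
    and hr: "hr_le N1 \<xi>1 N2 \<xi>2"
    and U1: "\<And>x. x \<in> E \<Longrightarrow> AE \<omega> in P x. \<forall>t\<ge>0. X t \<omega> \<in> E"
            "markov_process M E X F P"
    and U2: "\<And>\<nu>1 \<nu>2 t. prob_space \<nu>1 \<Longrightarrow> sets \<nu>1 = sets (restrict_space borel E) \<Longrightarrow>
               prob_space \<nu>2 \<Longrightarrow> sets \<nu>2 = sets (restrict_space borel E) \<Longrightarrow>
               0 < t \<Longrightarrow> \<nu>1 \<preceq>st \<nu>2 \<Longrightarrow>
               distr (Q \<nu>1) borel (X t) \<preceq>st distr (Q \<nu>2) borel (X t)"
    and E1: "\<And>\<mu> t. \<mu> \<in> {\<mu>1, \<mu>2} \<Longrightarrow> 0 < t \<Longrightarrow> diffuse (distr (Q \<mu>) borel (X t))"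
    and E2: "\<And>\<mu>. \<mu> \<in> {\<mu>1, \<mu>2} \<Longrightarrow> right_continuous_paths (Q \<mu>) X"
            "\<And>\<mu>. \<mu> \<in> {\<mu>1, \<mu>2} \<Longrightarrow> quasi_left_continuous (Q \<mu>) (usual_augmentation (Q \<mu>) F) X"
    and E3: "\<And>\<mu> b. \<mu> \<in> {\<mu>1, \<mu>2} \<Longrightarrow> boundary_function b \<Longrightarrow>
               AE \<omega> in Q \<mu>. first_passage X b \<omega> = strict_first_passage X b \<omega>"
  shows "\<exists>b1 b2. boundary_function b1 \<and> boundary_function b2 \<and>
           first_passage X b1 \<in> borel_measurable (completion (Q \<mu>1)) \<and>
           distr (completion (Q \<mu>1)) borel (first_passage X b1) = distr N1 borel (\<lambda>a. ennreal (\<xi>1 a)) \<and>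
           first_passage X b2 \<in> borel_measurable (completion (Q \<mu>2)) \<and>
           distr (completion (Q \<mu>2)) borel (first_passage X b2) = distr N2 borel (\<lambda>a. ennreal (\<xi>2 a)) \<and>
           (\<forall>t. b1 t \<le> b2 t)"
proof -
  interpret markov_family M E X F P
    by (rule markov_family.intro) (fact E F adapted U1)+
  have law: "law_on_E \<mu>1" "law_on_E \<mu>2" using \<mu> by (simp_all add: law_on_E_def)
  have mono: monotone_semigroup
    using U2 unfolding monotone_semigroup_def law_on_E_def Q_def by blast
  let ?G1 = "survival N1 \<xi>1" and ?G2 = "survival N2 \<xi>2"
  have grid_le: "grid_boundary \<mu>1 ?G1 n u \<le> grid_boundary \<mu>2 ?G2 n u" for n u
    unfolding grid_boundary_def
  proof (rule on_grid_mono)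
    fix k
    show "barrier (start_law (space M) X P \<mu>1) (\<lambda>k. X (real k * (1 / 2 ^ n))) (\<lambda>k. ?G1 (real k * (1 / 2 ^ n))) (Suc k)
       \<le> barrier (start_law (space M) X P \<mu>2) (\<lambda>k. X (real k * (1 / 2 ^ n))) (\<lambda>k. ?G2 (real k * (1 / 2 ^ n))) (Suc k)"
    proof (rule barrier_le_barrier[OF mono law st])
      show "diffuse (distr (start_law (space M) X P \<mu>1) borel (X t))" "diffuse (distr (start_law (space M) X P \<mu>2) borel (X t))"
        if "0 < t" for t
        using E1[of _ t] that unfolding Q_def by auto
      show "antimono (\<lambda>k. ?G1 (real k * (1 / 2 ^ n)))" "antimono (\<lambda>k. ?G2 (real k * (1 / 2 ^ n)))"
        by (intro antimonoI antimonoD[OF survival_antimono[OF \<xi>1(1,2)]]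
            antimonoD[OF survival_antimono[OF \<xi>2(1,2)]]; simp add: divide_right_mono)+
      show "?G1 (real (Suc k) * (1 / 2 ^ n)) * ?G2 (real k * (1 / 2 ^ n))
          \<le> ?G1 (real k * (1 / 2 ^ n)) * ?G2 (real (Suc k) * (1 / 2 ^ n))" for k
        by (rule hr_le_survival(2)[OF \<xi>1(1,2) \<xi>2(1,2) hr]) (auto intro: divide_right_mono)
      show "?G1 (real k * (1 / 2 ^ n)) = 0" if "?G2 (real k * (1 / 2 ^ n)) = 0" for k
        using that by (intro hr_le_survival(1)[OF \<xi>1(1,2) \<xi>2(1,2) hr]) auto
    qed (auto simp: survival_0[OF \<xi>1] survival_0[OF \<xi>2] survival_nonneg[OF \<xi>1(1,2)] survival_nonneg[OF \<xi>2(1,2)])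
  qed simp
  \<comment> \<open>The Boolean puts both families through a single extraction, and rational windows
    and thresholds keep the index type countable.\<close>
  define A where "A = (\<lambda>(i, a, c, q) n. \<exists>u\<in>{of_rat a<..<of_rat c}.
      (if i then grid_boundary \<mu>1 ?G1 n u else grid_boundary \<mu>2 ?G2 n u) < ereal (of_rat q))"
  obtain r :: "nat \<Rightarrow> nat" where r: "strict_mono r"
    and dich: "\<And>k. (\<forall>\<^sub>F n in sequentially. A k (r n)) \<or> (\<forall>\<^sub>F n in sequentially. \<not> A k (r n))"
    using diagonal_dichotomy[of A] by blast
  define f1 where "f1 = (\<lambda>n. grid_boundary \<mu>1 ?G1 (r n))"
  define f2 where "f2 = (\<lambda>n. grid_boundary \<mu>2 ?G2 (r n))"
  have recovery1: "\<forall>\<^sub>F n in sequentially. \<exists>u. \<bar>u - t\<bar> < \<delta> \<and> f1 n u < q"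
    if "gamma_liminf f1 t < q" "0 < \<delta>" for t q \<delta>
  proof (rule gamma_liminf_lessD[OF _ that])
    fix a c q
    show "(\<forall>\<^sub>F n in sequentially. \<exists>u\<in>{of_rat a<..<of_rat c}. f1 n u < ereal (of_rat q)) \<or>
        (\<forall>\<^sub>F n in sequentially. \<not> (\<exists>u\<in>{of_rat a<..<of_rat c}. f1 n u < ereal (of_rat q)))"
      using dich[of "(True, a, c, q)"] by (simp add: A_def f1_def)
  qed
  have recovery2: "\<forall>\<^sub>F n in sequentially. \<exists>u. \<bar>u - t\<bar> < \<delta> \<and> f2 n u < q"
    if "gamma_liminf f2 t < q" "0 < \<delta>" for t q \<delta>
  proof (rule gamma_liminf_lessD[OF _ that])
    fix a c q
    show "(\<forall>\<^sub>F n in sequentially. \<exists>u\<in>{of_rat a<..<of_rat c}. f2 n u < ereal (of_rat q)) \<or>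
        (\<forall>\<^sub>F n in sequentially. \<not> (\<exists>u\<in>{of_rat a<..<of_rat c}. f2 n u < ereal (of_rat q)))"
      using dich[of "(False, a, c, q)"] by (simp add: A_def f2_def)
  qed
  have in1: "\<mu>1 \<in> {\<mu>1, \<mu>2}" and in2: "\<mu>2 \<in> {\<mu>1, \<mu>2}" by auto
  note lim1 = first_passage_limit[OF law(1) E1[OF in1, unfolded Q_def] E2(1)[OF in1, unfolded Q_def]
      E2(2)[OF in1, unfolded Q_def] E3[OF in1, unfolded Q_def] \<xi>1 r f1_def recovery1]
  note lim2 = first_passage_limit[OF law(2) E1[OF in2, unfolded Q_def] E2(1)[OF in2, unfolded Q_def]
      E2(2)[OF in2, unfolded Q_def] E3[OF in2, unfolded Q_def] \<xi>2 r f2_def recovery2]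
  have "gamma_liminf f1 t \<le> gamma_liminf f2 t" for t
    by (rule gamma_liminf_mono) (simp add: f1_def f2_def grid_le)
  then have "boundary_of (gamma_liminf f1) t \<le> boundary_of (gamma_liminf f2) t" for t
    by (simp add: boundary_of_def)
  with lim1 lim2 show ?thesis
    unfolding Q_def
    by (intro exI[of _ "boundary_of (gamma_liminf f1)"] exI[of _ "boundary_of (gamma_liminf f2)"] conjI allI
        boundary_function_gamma_liminf)
qed

end
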